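(* (a) For every irrational real $s>1$, $\operatorname{ltan}(\operatorname{larctan}s)=s$. (b) For every ordinary lattice R-irrational angle $\alpha$, $\operatorname{larctan}(\operatorname{ltan}\alpha)$ is lattice-congruent to $\alpha$.
   Context: We work in $\mathbb R^2$ with lattice $\mathbb Z^2$ and origin $O$. A lattice-affine transformation is $x\mapsto Mx+b$, $M\in GL_2(\mathbb Z)$, $b\in\mathbb Z^2$. $\operatorname{l\ell}(AB)$ is the number of lattice points on lattice segment $AB$ minus one. For an ordinary lattice angle $\angle XYZ$ ($X,Y,Z$ lattice points not collinear, rays $YX$, $YZ$): let $v_1,v_2$ be primitive lattice vectors along $YX$, $YZ$; lattice points $P$ with $(v_1,P-Y)$ a basis form two lines parallel to $YX$; ray $YZ$ meets exactly one, $l$, at $Q$; $D$ is the lattice point of $l$ nearest $Q$ among those strictly on the other side of line $YZ$ from $X$; writing $v_2=x_1v_1+x_2(D-Y)$, $\operatorname{lsin}\angle XYZ=x_2$. An angle $\angle AOB$ with lattice vertex $O$ ($O,A,B$ not collinear; the angle is the ordered pair of rays $OA$, $OB$) is an ordinary lattice R-irrational angle if the open ray $OA$ contains lattice points and the open ray $OB$ contains none. Two such angles are lattice-congruent if a lattice-affine map sends vertex to vertex, ray $OA$ onto ray $O'A'$ and ray $OB$ onto ray $O'B'$. Sail: let $C$ be the closed convex cone spanned by rays $OA$, $OB$ and $H$ the convex hull of $(C\cap\mathbb Z^2)\setminus\{O\}$; the sail is the closure of the intersection of the boundary of $H$ with the open cone; it is an infinite broken line oriented from ray $OA$ toward ray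 $OB$, with vertices (lattice points not interior to a segment of the sail) $V_0,V_1,V_2,\dots$ in order, $V_0$ on ray $OA$. The lattice tangent is the infinite continued fraction $\operatorname{ltan}\angle AOB=[\operatorname{l\ell}(V_0V_1);\operatorname{lsin}\angle V_0V_1V_2,\operatorname{l\ell}(V_1V_2),\operatorname{lsin}\angle V_1V_2V_3,\dots]$, where $[a_0;a_1,a_2,\dots]=\lim_{k\to\infty}[a_0;a_1,\dots,a_k]$ for positive integers $a_i$. For irrational $s>1$, $\operatorname{larctan}s$ is the angle $\angle AOB$ with $A=(1,0)$, $B=(1,s)$. *)

theory Defs
  imports "HOL-Analysis.Analysis"
begin

definition int_lattice :: "(real^2) set" where
  "int_lattice = {x. \<forall>i. x $ i \<in> \<int>}"

text \<open>Invertibility of \<open>M\<close> is over the integers, so \<open>M\<close> ranges over $GL_2(\mathbb Z)$.\<close>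

definition lattice_affine :: "(real^2 \<Rightarrow> real^2) \<Rightarrow> bool" where
  "lattice_affine f \<longleftrightarrow> (\<exists>(M::int^2^2) (b::int^2). invertible M \<and>
     f = (\<lambda>x. (\<chi> i j. real_of_int (M $ i $ j)) *v x + (\<chi> i. real_of_int (b $ i))))"

definition lattice_length :: "real^2 \<Rightarrow> real^2 \<Rightarrow> nat" where
  "lattice_length A B = card (closed_segment A B \<inter> int_lattice) - 1"

definition ray :: "real^2 \<Rightarrow> real^2 \<Rightarrow> (real^2) set" where
  "ray Y X = {Y + t *\<^sub>R (X - Y) | t. t \<ge> 0}"

definition primitive_vector :: "real^2 \<Rightarrow> bool" where
  "primitive_vector v \<longleftrightarrow>
     (\<exists>a b :: int. coprime a b \<and> v = vector [real_of_int a, real_of_int b])"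

definition lattice_basis :: "real^2 \<Rightarrow> real^2 \<Rightarrow> bool" where
  "lattice_basis u v \<longleftrightarrow> u \<in> int_lattice \<and> v \<in> int_lattice \<and>
     (\<forall>w\<in>int_lattice. \<exists>!mn :: int \<times> int.
        w = real_of_int (fst mn) *\<^sub>R u + real_of_int (snd mn) *\<^sub>R v)"

definition basis_lines :: "real^2 \<Rightarrow> real^2 \<Rightarrow> (real^2) set set" where
  "basis_lines Y v = {range (\<lambda>t::real. P + t *\<^sub>R v) | P. P \<in> int_lattice \<and> lattice_basis v (P - Y)}"

definition det2 :: "real^2 \<Rightarrow> real^2 \<Rightarrow> real" where
  "det2 u v = u $ 1 * v $ 2 - u $ 2 * v $ 1"

text \<open>\<open>P\<close> and \<open>X\<close> lie strictly on different sides of the line through \<open>Y\<close> and \<open>Z\<close>.\<close>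

definition opposite_sides :: "real^2 \<Rightarrow> real^2 \<Rightarrow> real^2 \<Rightarrow> real^2 \<Rightarrow> bool" where
  "opposite_sides Y Z X P \<longleftrightarrow> det2 (Z - Y) (X - Y) * det2 (Z - Y) (P - Y) < 0"

text \<open>For non-collinear lattice points \<open>X\<close>, \<open>Y\<close>, \<open>Z\<close> all the objects quantified here are
  uniquely determined.\<close>

definition lsin :: "real^2 \<Rightarrow> real^2 \<Rightarrow> real^2 \<Rightarrow> real" where
  "lsin X Y Z = (THE x2. \<exists>v1 v2 l Q D x1.
     primitive_vector v1 \<and> Y + v1 \<in> ray Y X \<and>
     primitive_vector v2 \<and> Y + v2 \<in> ray Y Z \<and>
     l \<in> basis_lines Y v1 \<and> Q \<in> l \<and> Q \<in> ray Y Z \<and>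
     is_arg_min (\<lambda>P. dist P Q) (\<lambda>P. P \<in> l \<and> P \<in> int_lattice \<and> opposite_sides Y Z X P) D \<and>
     v2 = x1 *\<^sub>R v1 + x2 *\<^sub>R (D - Y))"

text \<open>An angle is an ordered pair of rays with a common vertex.\<close>

datatype angle = Angle (vertex: "real^2") (ray1: "(real^2) set") (ray2: "(real^2) set")

definition angle_of :: "real^2 \<Rightarrow> real^2 \<Rightarrow> real^2 \<Rightarrow> angle" where
  "angle_of A Y B = Angle Y (ray Y A) (ray Y B)"

definition R_irrational_angle :: "angle \<Rightarrow> bool" where
  "R_irrational_angle \<alpha> \<longleftrightarrow> (\<exists>A Y B. \<alpha> = angle_of A Y B \<and> Y \<in> int_lattice \<and>
     \<not> collinear {Y, A, B} \<and>
     (ray Y A - {Y}) \<inter> int_lattice \<noteq> {} \<and> (ray Y B - {Y}) \<inter> int_lattice = {})"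

definition lattice_congruent :: "angle \<Rightarrow> angle \<Rightarrow> bool" where
  "lattice_congruent \<alpha> \<beta> \<longleftrightarrow> (\<exists>f. lattice_affine f \<and> f (vertex \<alpha>) = vertex \<beta> \<and>
     f ` ray1 \<alpha> = ray1 \<beta> \<and> f ` ray2 \<alpha> = ray2 \<beta>)"

definition angle_cone :: "angle \<Rightarrow> (real^2) set" where
  "angle_cone \<alpha> = convex hull (ray1 \<alpha> \<union> ray2 \<alpha>)"

definition sail :: "angle \<Rightarrow> (real^2) set" where
  "sail \<alpha> = closure (frontier (convex hull (angle_cone \<alpha> \<inter> int_lattice - {vertex \<alpha>}))
                      \<inter> interior (angle_cone \<alpha>))"

definition sail_vertices :: "angle \<Rightarrow> (real^2) set" where
  "sail_vertices \<alpha> = {v \<in> sail \<alpha> \<inter> int_lattice.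
     \<not> (\<exists>p q. closed_segment p q \<subseteq> sail \<alpha> \<and> v \<in> open_segment p q)}"

text \<open>The vertices in the order in which the broken line passes through them, starting from the
  first ray: consecutive vertices are joined by a segment of the sail.\<close>

definition sail_vertex_seq :: "angle \<Rightarrow> (nat \<Rightarrow> real^2) \<Rightarrow> bool" where
  "sail_vertex_seq \<alpha> V \<longleftrightarrow> inj V \<and> range V = sail_vertices \<alpha> \<and> V 0 \<in> ray1 \<alpha> \<and>
     (\<forall>n. closed_segment (V n) (V (Suc n)) \<subseteq> sail \<alpha>)"

definition sail_vertex :: "angle \<Rightarrow> nat \<Rightarrow> real^2" where
  "sail_vertex \<alpha> = (THE V. sail_vertex_seq \<alpha> V)"

text \<open>\<open>cfrac [a\<^sub>0, \<dots>, a\<^sub>k]\<close> is the finite continued fraction $[a_0; a_1, \dots, a_k]$.\<close>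

fun cfrac :: "real list \<Rightarrow> real" where
  "cfrac [] = 0"
| "cfrac [a] = a"
| "cfrac (a # b # as) = a + 1 / cfrac (b # as)"

definition infinite_cfrac :: "(nat \<Rightarrow> real) \<Rightarrow> real" where
  "infinite_cfrac a = lim (\<lambda>k. cfrac (map a [0..<Suc k]))"

definition ltan_coeff :: "angle \<Rightarrow> nat \<Rightarrow> real" where
  "ltan_coeff \<alpha> n = (let V = sail_vertex \<alpha>; k = n div 2 in
     if even n then real (lattice_length (V k) (V (k + 1)))
     else lsin (V k) (V (k + 1)) (V (k + 2)))"

definition ltan :: "angle \<Rightarrow> real" where
  "ltan \<alpha> = infinite_cfrac (ltan_coeff \<alpha>)"

text \<open>Only meaningful for irrational \<open>s > 1\<close>.\<close>

definition larctan :: "real \<Rightarrow> angle" where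
  "larctan s = angle_of (vector [1, 0]) 0 (vector [1, s])"

end

theory Submission
  imports Defs
begin

text \<open>Let $s = [a_0; a_1, a_2, \ldots]$ with convergents $p_n / q_n$, and put
  $V_k = (q_{2k-2}, p_{2k-2})$ and $W_k = (q_{2k-1}, p_{2k-1})$, so that
  $V_{k+1} = V_k + a_{2k} W_k$, $W_{k+1} = W_k + a_{2k+1} V_{k+1}$ and $\det(V_k, W_k) = 1$.
  The $W_k$ lie above the line $y = s x$, hence $\det(P, W_k)$ is a positive integer for every nonzero
  lattice point $P$ of the cone, and it equals 1 on the segment $V_k V_{k+1}$. As the slopes of the
  $V_k$ tend to $s$, the cones spanned by $V_k$ and $V_{k+1}$ exhaust the angle, so the sail is the broken line
  $V_0 V_1 V_2 \ldots$. Its lattice lengths are the $a_{2k}$, and its lattice sines are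
  $|\det(W_k, W_{k+1})| = a_{2k+1}$. Finally, every R-irrational angle is the image of some
  $\operatorname{larctan} s$ under a unimodular change of lattice frame, which preserves all of this.\<close>

section \<open>Lattice vectors and determinants\<close>

text \<open>The half-planes \<open>det2 p (W k) \<ge> 1\<close> bound the hull \<open>H\<close> only
  from outside. That no point beyond the broken line stays on the frontier needs the converse:
  \<open>H\<close> is stable under adding vectors of the open cone. The second ray carries no
  lattice points, so this stability has to be built from the \<open>V k\<close>, and it reaches the
  whole open cone only because the slopes converge. The functionals \<open>det2 _ (W k)\<close> also
  carry the combinatorics. Each is at least 1 on the sail and equals 1 at no vertex besides the two
  ends of its edge, and a linear functional that is minimal inside a segment is constant on it. This
  decides both which points are vertices and which vertices are joined in the sail. Adjacency
  matters because the vertex sequence is given by a definite description: \<open>ltan\<close> can be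
  computed only after the enumeration is known to be unique. Two boundary effects need care:
  \<open>V 0\<close> lies outside the open cone and returns only through the closure, and the broken
  line has infinitely many edges, so its closedness rests on the growth of the second
  coordinate.\<close>

lemma det2_simps [simp]:
  "det2 (u + v) w = det2 u w + det2 v w" "det2 w (u + v) = det2 w u + det2 w v"
  "det2 (u - v) w = det2 u w - det2 v w" "det2 w (u - v) = det2 w u - det2 w v"
  "det2 (- u) w = - det2 u w" "det2 w (- u) = - det2 w u"
  "det2 (c *\<^sub>R u) w = c * det2 u w" "det2 w (c *\<^sub>R u) = c * det2 w u"
  "det2 u u = 0" "det2 0 u = 0" "det2 u 0 = 0"
  by (simp_all add: det2_def algebra_simps)

lemma det2_swap: "det2 u v = - det2 v u"
  by (simp add: det2_def)

text \<open>Cramer's rule with the denominator cleared; it is an identity even for dependent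
  \<open>u\<close> and \<open>v\<close>.\<close>

lemma det2_cramer: "det2 u v *\<^sub>R p = det2 p v *\<^sub>R u + det2 u p *\<^sub>R v"
  by (simp add: vec_eq_iff forall_2 det2_def algebra_simps)

lemma det2_eqI:
  assumes "det2 u v \<noteq> 0" "det2 u p = det2 u q" "det2 v p = det2 v q"
  shows "p = q"
proof -
  have "det2 u v *\<^sub>R p = det2 u v *\<^sub>R q"
    using assms det2_swap[of p v] det2_swap[of q v] by (simp add: det2_cramer[of u v])
  then show ?thesis using assms(1) by simp
qed

lemma int_lattice_intros [intro, simp]:
  "0 \<in> int_lattice"
  "u \<in> int_lattice \<Longrightarrow> v \<in> int_lattice \<Longrightarrow> u + v \<in> int_lattice"
  "u \<in> int_lattice \<Longrightarrow> v \<in> int_lattice \<Longrightarrow> u - v \<in> int_lattice"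
  "u \<in> int_lattice \<Longrightarrow> - u \<in> int_lattice"
  "c \<in> \<int> \<Longrightarrow> u \<in> int_lattice \<Longrightarrow> c *\<^sub>R u \<in> int_lattice"
  by (auto simp: int_lattice_def)

lemma vector_in_int_lattice_iff [simp]:
  "(vector [a, b] :: real^2) \<in> int_lattice \<longleftrightarrow> a \<in> \<int> \<and> b \<in> \<int>"
  by (simp add: int_lattice_def forall_2)

lemma vec2_eqI: "(p::real^2) $ 1 = q $ 1 \<Longrightarrow> p $ 2 = q $ 2 \<Longrightarrow> p = q"
  by (simp add: vec_eq_iff forall_2)

lemma det2_in_Ints: "u \<in> int_lattice \<Longrightarrow> v \<in> int_lattice \<Longrightarrow> det2 u v \<in> \<int>"
  by (simp add: det2_def int_lattice_def)

lemma primitive_vector_in_int_lattice: "primitive_vector v \<Longrightarrow> v \<in> int_lattice"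
  by (auto simp: primitive_vector_def)

text \<open>A common divisor of the coordinates of \<open>u\<close> divides the determinant, which
  is a unit.\<close>

lemma primitive_vectorI:
  assumes "u \<in> int_lattice" "v \<in> int_lattice" "\<bar>det2 u v\<bar> = 1"
  shows "primitive_vector u"
proof -
  obtain a b c d :: int where ab: "u $ 1 = a" "u $ 2 = b" "v $ 1 = c" "v $ 2 = d"
    using assms(1,2) by (auto simp: int_lattice_def forall_2 elim!: Ints_cases)
  have "\<bar>real_of_int (a * d - b * c)\<bar> = 1"
    using assms(3) ab by (simp add: det2_def)
  then have "\<bar>a * d - b * c\<bar> = 1" by linarith
  then have "coprime a b"
    by (intro coprimeI) (metis dvd_abs_iff dvd_diff dvd_mult2)
  moreover have "u = vector [real_of_int a, real_of_int b]"
    using ab by (intro vec2_eqI) auto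
  ultimately show ?thesis unfolding primitive_vector_def by blast
qed

text \<open>Bezout's identity scaled by \<open>c\<close>. With \<open>c\<close> equal to 1 or -1 it
  completes \<open>v\<close> to a lattice basis of prescribed orientation.\<close>

lemma primitive_vector_complement:
  assumes "primitive_vector v" "c \<in> \<int>"
  obtains w where "w \<in> int_lattice" "det2 v w = c"
proof -
  obtain a b where v: "coprime a b" "v = vector [real_of_int a, real_of_int b]"
    using assms(1) unfolding primitive_vector_def by auto
  obtain x y where "x * a + y * b = 1"
    using bezout_int[of a b] v(1) by auto
  then have *: "real_of_int x * a + real_of_int y * b = 1"
    by (metis of_int_1 of_int_add of_int_mult)
  show thesis
  proof (rule that[of "vector [- c * y, c * x]"])
    have "det2 v (vector [- c * y, c * x]) = c * (real_of_int x * a + real_of_int y * b)"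
      by (simp add: det2_def v(2) algebra_simps)
    then show "det2 v (vector [- c * y, c * x]) = c" by (simp only: * mult_1_right)
  qed (use assms(2) in auto)
qed

lemma primitive_vector_scaleR_in_int_lattice:
  assumes "primitive_vector v" "t *\<^sub>R v \<in> int_lattice"
  shows "t \<in> \<int>"
proof -
  obtain w where "w \<in> int_lattice" "det2 v w = 1"
    using primitive_vector_complement[OF assms(1), of 1] by auto
  then show ?thesis using det2_in_Ints[OF assms(2)] by fastforce
qed

text \<open>Pairing with a complement of \<open>u\<close> writes 1 as a product of integers with
  factor \<open>t\<close>, so \<open>t\<close> is a unit, and its sign leaves 1. This makes the
  direction vectors in \<open>lsin\<close> unique.\<close>

lemma primitive_vector_same_direction:
  assumes "primitive_vector u" "primitive_vector v" "u = t *\<^sub>R v" "t \<ge> 0"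
  shows "u = v"
proof -
  have "t \<in> \<int>"
    using assms primitive_vector_scaleR_in_int_lattice primitive_vector_in_int_lattice by blast
  then obtain k where k: "t = of_int k" by (auto elim: Ints_cases)
  obtain w where w: "w \<in> int_lattice" "det2 u w = 1"
    using primitive_vector_complement[OF assms(1), of 1] by auto
  obtain l where l: "det2 v w = of_int l"
    using det2_in_Ints[OF primitive_vector_in_int_lattice[OF assms(2)] w(1)] by (auto elim: Ints_cases)
  have "real_of_int (k * l) = 1" using w(2) k l assms(3) by simp
  then have "k * l = 1" by linarith
  then have "k = 1" using k assms(4) by (metis neg_0_le_iff_le not_one_le_zero of_int_0_le_iff zmult_eq_1_iff)
  then show ?thesis using k assms(3) by simp
qed

lemma primitive_vector_along:
  assumes "u \<in> int_lattice" "u \<noteq> 0"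
  obtains v t where "primitive_vector v" "t > 0" "u = t *\<^sub>R v"
proof -
  obtain a b :: int where ab: "u $ 1 = a" "u $ 2 = b"
    using assms(1) by (auto simp: int_lattice_def forall_2 elim!: Ints_cases)
  have nz: "a \<noteq> 0 \<or> b \<noteq> 0" using assms(2) ab by (auto simp: vec_eq_iff forall_2)
  then obtain a' b' where *: "a = a' * gcd a b" "b = b' * gcd a b" "coprime a' b'"
    using gcd_coprime_exists[of a b] by auto
  show thesis
  proof (rule that[of "vector [real_of_int a', real_of_int b']" "of_int (gcd a b)"])
    show "u = real_of_int (gcd a b) *\<^sub>R vector [real_of_int a', real_of_int b']"
      using ab * by (intro vec2_eqI) (simp_all add: mult.commute flip: of_int_mult)
    show "0 < real_of_int (gcd a b)" using nz by simp
  qed (use *(3) in \<open>auto simp: primitive_vector_def\<close>)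
qed

text \<open>Expanding the two standard basis vectors in \<open>u\<close>, \<open>v\<close> writes
  their determinant 1 as an integer times \<open>det2 u v\<close>.\<close>

lemma lattice_basis_det2:
  assumes "lattice_basis u v"
  shows "\<bar>det2 u v\<bar> = 1"
proof -
  have uv: "u \<in> int_lattice" "v \<in> int_lattice" using assms by (auto simp: lattice_basis_def)
  then obtain d where d: "det2 u v = of_int d" using det2_in_Ints by (blast elim: Ints_cases)
  have ex: "\<exists>m n::int. w = of_int m *\<^sub>R u + of_int n *\<^sub>R v" if "w \<in> int_lattice" for w
    using assms that unfolding lattice_basis_def by blast
  obtain m n m' n' :: int where
    1: "vector [1, 0] = of_int m *\<^sub>R u + of_int n *\<^sub>R v" and
    2: "vector [0, 1] = of_int m' *\<^sub>R u + of_int n' *\<^sub>R v"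
    using ex[of "vector [1, 0]"] ex[of "vector [0, 1]"] by auto
  have "1 = det2 (vector [1, 0]) (vector [0, 1])" by (simp add: det2_def)
  also have "\<dots> = of_int ((m * n' - n * m') * d)"
    unfolding 1 2 using d det2_swap[of v u] by (simp add: algebra_simps)
  finally have "(m * n' - n * m') * d = 1" by linarith
  then have "\<bar>d\<bar> = 1" by (metis abs_mult abs_1 zmult_eq_1_iff abs_minus_cancel)
  then show ?thesis using d by simp
qed

lemma lattice_basisI:
  assumes uv: "u \<in> int_lattice" "v \<in> int_lattice" and det: "\<bar>det2 u v\<bar> = 1"
  shows "lattice_basis u v"
  unfolding lattice_basis_def
proof (intro conjI ballI uv)
  fix w assume w: "w \<in> int_lattice"
  define d where "d = det2 u v"
  have d: "d = 1 \<or> d = -1" using det by (auto simp: d_def)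
  obtain m n where mn: "d * det2 w v = of_int m" "d * det2 u w = of_int n"
    using uv w d by (metis Ints_mult Ints_cases det2_in_Ints d_def)
  have "w = d *\<^sub>R (d *\<^sub>R w)" using d by auto
  also have "d *\<^sub>R w = det2 w v *\<^sub>R u + det2 u w *\<^sub>R v" unfolding d_def by (rule det2_cramer)
  finally have w_eq: "w = of_int m *\<^sub>R u + of_int n *\<^sub>R v"
    using mn by (simp add: algebra_simps)
  show "\<exists>!mn::int \<times> int. w = of_int (fst mn) *\<^sub>R u + of_int (snd mn) *\<^sub>R v"
  proof (rule ex1I[of _ "(m, n)"])
    fix mn' :: "int \<times> int" assume *: "w = of_int (fst mn') *\<^sub>R u + of_int (snd mn') *\<^sub>R v"
    have "det2 w v = of_int (fst mn') * d" by (subst *) (simp add: d_def)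
    moreover have "det2 w v = of_int m * d" by (subst w_eq) (simp add: d_def)
    moreover have "det2 u w = of_int (snd mn') * d" by (subst *) (simp add: d_def)
    moreover have "det2 u w = of_int n * d" by (subst w_eq) (simp add: d_def)
    ultimately show "mn' = (m, n)" using d by (auto simp: prod_eq_iff)
  qed (use w_eq in simp)
qed

section \<open>Lattice length and lattice sine\<close>

lemma lattice_length_primitive:
  assumes "P \<in> int_lattice" "primitive_vector w"
  shows "lattice_length P (P + real n *\<^sub>R w) = n"
proof -
  have w0: "w \<noteq> 0" using assms(2) by (auto simp: primitive_vector_def vec_eq_iff forall_2)
  have wl: "w \<in> int_lattice" by (rule primitive_vector_in_int_lattice[OF assms(2)])
  have "closed_segment P (P + real n *\<^sub>R w) \<inter> int_lattice = (\<lambda>j. P + real j *\<^sub>R w) ` {..n}"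
  proof (intro equalityI subsetI)
    fix Q assume Q: "Q \<in> closed_segment P (P + real n *\<^sub>R w) \<inter> int_lattice"
    then obtain t where t: "0 \<le> t" "t \<le> 1" "Q = P + (t * real n) *\<^sub>R w"
      by (auto simp: in_segment algebra_simps)
    have "(t * real n) *\<^sub>R w = Q - P" using t by simp
    also have "\<dots> \<in> int_lattice" using Q assms(1) by blast
    finally have "t * real n \<in> \<int>" using primitive_vector_scaleR_in_int_lattice[OF assms(2)] by blast
    then obtain i where i: "t * real n = of_int i" by (auto elim: Ints_cases)
    have "0 \<le> t * real n" "t * real n \<le> real n" using t by (auto simp: mult_left_le_one_le)
    then have "0 \<le> i" "i \<le> int n" using i by linarith+
    then have "Q = P + real (nat i) *\<^sub>R w" "nat i \<le> n" using t(3) i by auto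
    then show "Q \<in> (\<lambda>j. P + real j *\<^sub>R w) ` {..n}" by blast
  next
    fix Q assume "Q \<in> (\<lambda>j. P + real j *\<^sub>R w) ` {..n}"
    then obtain j where j: "j \<le> n" "Q = P + real j *\<^sub>R w" by auto
    have "Q = (1 - real j / real n) *\<^sub>R P + (real j / real n) *\<^sub>R (P + real n *\<^sub>R w)"
      using j by (cases "n = 0") (auto simp: algebra_simps)
    then have "Q \<in> closed_segment P (P + real n *\<^sub>R w)"
      unfolding in_segment using j by (intro exI[of _ "real j / real n"]) (auto simp: divide_le_eq_1)
    then show "Q \<in> closed_segment P (P + real n *\<^sub>R w) \<inter> int_lattice"
      using j assms(1) wl by auto
  qed
  moreover have "inj_on (\<lambda>j. P + real j *\<^sub>R w) {..n}" using w0 by (auto simp: inj_on_def)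
  ultimately show ?thesis unfolding lattice_length_def by (simp add: card_image)
qed

text \<open>In a basis \<open>v1\<close>, \<open>w\<close> with \<open>w\<close> on the side of
  \<open>v2\<close>, the vector \<open>v2\<close> is \<open>d\<close> times a point of the line
  \<open>w + t v1\<close>. Since \<open>D - Y\<close> is a point of that same line, its
  \<open>w\<close>-coordinate is 1, and the coefficient \<open>x2\<close> must be
  \<open>d\<close>.\<close>

lemma lsin_primitive:
  assumes Y: "Y \<in> int_lattice" and v1: "primitive_vector v1" and v2: "primitive_vector v2"
    and m: "m > 0" and n: "n > 0" and det: "det2 v1 v2 \<noteq> 0"
  shows "lsin (Y + m *\<^sub>R v1) Y (Y + n *\<^sub>R v2) = \<bar>det2 v1 v2\<bar>"
  unfolding lsin_def
proof (rule the_equality)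
  let ?X = "Y + m *\<^sub>R v1" and ?Z = "Y + n *\<^sub>R v2"
  \<comment> \<open>The orientation of the pair: a complement \<open>w\<close> with determinant
    \<open>\<sigma>\<close> lies on the same side of the line along \<open>v1\<close> as
    \<open>v2\<close>, so the ray meets the line through \<open>Y + w\<close>.\<close>
  define \<sigma> where "\<sigma> = sgn (det2 v1 v2)"
  define d where "d = \<bar>det2 v1 v2\<bar>"
  have d: "d > 0" "det2 v1 v2 = \<sigma> * d" using det by (auto simp: d_def \<sigma>_def sgn_if)
  have \<sigma>: "\<sigma> = 1 \<or> \<sigma> = -1" using det by (auto simp: \<sigma>_def sgn_if)
  then have "\<sigma> \<in> \<int>" by auto
  then obtain w where w: "w \<in> int_lattice" "det2 v1 w = \<sigma>"
    using primitive_vector_complement[OF v1] by blast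
  have v1l: "v1 \<in> int_lattice" using v1 by (rule primitive_vector_in_int_lattice)
  \<comment> \<open>The parameter at which the ray along \<open>v2\<close> crosses the line
    \<open>Y + w + t v1\<close>.\<close>
  define q where "q = \<sigma> * det2 v2 w / d"
  have v2_eq: "v2 = d *\<^sub>R (w + q *\<^sub>R v1)"
  proof (rule det2_eqI[of v1 w])
    show "det2 v1 w \<noteq> 0" using w \<sigma> by auto
    show "det2 v1 v2 = det2 v1 (d *\<^sub>R (w + q *\<^sub>R v1))" using d w by simp
    have "\<sigma> * \<sigma> = 1" using \<sigma> by auto
    then show "det2 w v2 = det2 w (d *\<^sub>R (w + q *\<^sub>R v1))"
      using d w det2_swap[of w v1] det2_swap[of w v2] by (simp add: q_def algebra_simps)
  qed
  define l where "l = range (\<lambda>t::real. (Y + w) + t *\<^sub>R v1)"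
  define Q where "Q = Y + w + q *\<^sub>R v1"
  \<comment> \<open>The largest integer strictly below \<open>q\<close>. The floor would be wrong
    for integral \<open>q\<close>, where the lattice point \<open>Q\<close> lies on the line
    \<open>YZ\<close> and not strictly beyond it.\<close>
  define j where "j = \<lceil>q\<rceil> - 1"
  define D where "D = Y + w + of_int j *\<^sub>R v1"
  have opp: "opposite_sides Y ?Z ?X (Y + w + t *\<^sub>R v1) \<longleftrightarrow> t < q" for t
  proof -
    have "det2 v2 (w + t *\<^sub>R v1) = d * (det2 w v1 * (t - q))"
      unfolding v2_eq using det2_swap[of v1 w] by (simp add: algebra_simps)
    also have "\<dots> = d * \<sigma> * (q - t)" using w det2_swap[of w v1] by (simp add: algebra_simps)
    finally have 1: "det2 v2 w + t * det2 v2 v1 = d * \<sigma> * (q - t)" by simp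
    have 2: "det2 v2 v1 = - \<sigma> * d" using d det2_swap[of v1 v2] by simp
    have "det2 (?Z - Y) (?X - Y) * det2 (?Z - Y) (Y + w + t *\<^sub>R v1 - Y)
        = n * m * n * (det2 v2 v1 * (det2 v2 w + t * det2 v2 v1))" by (simp add: algebra_simps)
    also have "\<dots> = n * m * n * (- (\<sigma> * \<sigma>) * d * d * (q - t))"
      unfolding 1 unfolding 2 by (simp add: algebra_simps)
    also have "\<dots> = (n * m * n * d * d) * (t - q)"
      using \<sigma> by (auto simp: algebra_simps)
    finally have *: "det2 (?Z - Y) (?X - Y) * det2 (?Z - Y) (Y + w + t *\<^sub>R v1 - Y)
        = (n * m * n * d * d) * (t - q)" .
    have "n * m * n * d * d > 0" using n m d by simp
    then have "(n * m * n * d * d) * (t - q) < (n * m * n * d * d) * 0 \<longleftrightarrow> t - q < 0"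
      by (rule mult_less_cancel_left_pos)
    then show ?thesis
      unfolding opposite_sides_def * by (simp only: mult_zero_right diff_less_0_iff_less)
  qed
  have amin: "is_arg_min (\<lambda>P. dist P Q) (\<lambda>P. P \<in> l \<and> P \<in> int_lattice \<and> opposite_sides Y ?Z ?X P) D"
    unfolding is_arg_min_def
  proof (intro conjI notI)
    show "D \<in> l" by (auto simp: D_def l_def)
    show "D \<in> int_lattice" using Y w v1l by (auto simp: D_def)
    show "opposite_sides Y ?Z ?X D" unfolding D_def opp j_def by linarith
    assume "\<exists>P. (P \<in> l \<and> P \<in> int_lattice \<and> opposite_sides Y ?Z ?X P) \<and> dist P Q < dist D Q"
    then obtain t where P: "Y + w + t *\<^sub>R v1 \<in> int_lattice" "opposite_sides Y ?Z ?X (Y + w + t *\<^sub>R v1)"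
      "dist (Y + w + t *\<^sub>R v1) Q < dist D Q" by (auto simp: l_def)
    have "t *\<^sub>R v1 = (Y + w + t *\<^sub>R v1) - (Y + w)" by simp
    also have "\<dots> \<in> int_lattice" using P(1) Y w by blast
    finally obtain i where i: "t = of_int i"
      using primitive_vector_scaleR_in_int_lattice[OF v1] by (blast elim: Ints_cases)
    have dd: "dist (Y + w + r *\<^sub>R v1) Q = \<bar>r - q\<bar> * norm v1" for r
      by (simp add: Q_def dist_norm flip: scaleR_diff_left)
    have "t < q" using P(2) opp by simp
    then have "i \<le> j" using i unfolding j_def by linarith
    then have "t \<le> of_int j" "of_int j < q" using i by (auto simp: j_def) linarith
    then have "\<bar>of_int j - q\<bar> * norm v1 \<le> \<bar>t - q\<bar> * norm v1"
      by (intro mult_right_mono) auto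
    then show False using P(3) by (simp add: dd D_def)
  qed
  show "\<exists>u1 u2 l Q D x1. primitive_vector u1 \<and> Y + u1 \<in> ray Y ?X \<and>
     primitive_vector u2 \<and> Y + u2 \<in> ray Y ?Z \<and>
     l \<in> basis_lines Y u1 \<and> Q \<in> l \<and> Q \<in> ray Y ?Z \<and>
     is_arg_min (\<lambda>P. dist P Q) (\<lambda>P. P \<in> l \<and> P \<in> int_lattice \<and> opposite_sides Y ?Z ?X P) D \<and>
     u2 = x1 *\<^sub>R u1 + \<bar>det2 v1 v2\<bar> *\<^sub>R (D - Y)"
  proof (intro exI conjI)
    show "primitive_vector v1" "primitive_vector v2" by (fact v1 v2)+
    show "is_arg_min (\<lambda>P. dist P Q) (\<lambda>P. P \<in> l \<and> P \<in> int_lattice \<and> opposite_sides Y ?Z ?X P) D"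
      by (fact amin)
    show "Y + v1 \<in> ray Y ?X" using m by (auto simp: ray_def intro!: exI[of _ "1 / m"])
    show "Y + v2 \<in> ray Y ?Z" using n by (auto simp: ray_def intro!: exI[of _ "1 / n"])
    have "lattice_basis v1 (Y + w - Y)" using w v1l \<sigma> by (intro lattice_basisI) auto
    then show "l \<in> basis_lines Y v1" using Y w unfolding basis_lines_def l_def by blast
    show "Q \<in> l" by (auto simp: Q_def l_def)
    have "Q = Y + (1 / (d * n)) *\<^sub>R (?Z - Y)" using n d by (simp add: Q_def v2_eq)
    moreover have "1 / (d * n) \<ge> 0" using n d by simp
    ultimately show "Q \<in> ray Y ?Z" unfolding ray_def by blast
    show "v2 = (d * (q - of_int j)) *\<^sub>R v1 + \<bar>det2 v1 v2\<bar> *\<^sub>R (D - Y)"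
      unfolding d_def[symmetric] by (subst v2_eq) (simp add: D_def algebra_simps)
  qed
next
  let ?X = "Y + m *\<^sub>R v1" and ?Z = "Y + n *\<^sub>R v2"
  fix x2
  assume "\<exists>v1 v2 l Q D x1. primitive_vector v1 \<and> Y + v1 \<in> ray Y ?X \<and>
     primitive_vector v2 \<and> Y + v2 \<in> ray Y ?Z \<and>
     l \<in> basis_lines Y v1 \<and> Q \<in> l \<and> Q \<in> ray Y ?Z \<and>
     is_arg_min (\<lambda>P. dist P Q) (\<lambda>P. P \<in> l \<and> P \<in> int_lattice \<and> opposite_sides Y ?Z ?X P) D \<and>
     v2 = x1 *\<^sub>R v1 + x2 *\<^sub>R (D - Y)"
  then obtain v1' v2' l Q D x1 where *: "primitive_vector v1'" "Y + v1' \<in> ray Y ?X"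
     "primitive_vector v2'" "Y + v2' \<in> ray Y ?Z"
     "l \<in> basis_lines Y v1'" "Q \<in> l" "Q \<in> ray Y ?Z"
     and "is_arg_min (\<lambda>P. dist P Q) (\<lambda>P. P \<in> l \<and> P \<in> int_lattice \<and> opposite_sides Y ?Z ?X P) D"
     and eq: "v2' = x1 *\<^sub>R v1' + x2 *\<^sub>R (D - Y)"
    by blast
  then have D: "D \<in> l" by (simp add: is_arg_min_def)
  obtain t1 where t1: "t1 \<ge> 0" "v1' = (t1 * m) *\<^sub>R v1" using *(2) by (auto simp: ray_def)
  have v1': "v1' = v1" using primitive_vector_same_direction[OF *(1) v1 t1(2)] t1(1) m by simp
  obtain t2 where t2: "t2 \<ge> 0" "v2' = (t2 * n) *\<^sub>R v2" using *(4) by (auto simp: ray_def)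
  have v2': "v2' = v2" using primitive_vector_same_direction[OF *(3) v2 t2(2)] t2(1) n by simp
  obtain P where P: "l = range (\<lambda>t::real. P + t *\<^sub>R v1)" "lattice_basis v1 (P - Y)"
    using *(5) unfolding basis_lines_def v1' by auto
  define \<delta> where "\<delta> = det2 v1 (P - Y)"
  have \<delta>: "\<bar>\<delta>\<bar> = 1" using lattice_basis_det2[OF P(2)] by (simp add: \<delta>_def)
  have on_l: "det2 v1 (R - Y) = \<delta>" if "R \<in> l" for R
    using that unfolding P \<delta>_def by auto
  obtain r where r: "r \<ge> 0" "Q = Y + (r * n) *\<^sub>R v2" using *(7) by (auto simp: ray_def)
  have 1: "r * n * det2 v1 v2 = \<delta>" using on_l[OF *(6)] r(2) by simp
  have "det2 v1 v2 = x2 * det2 v1 (D - Y)" by (subst eq[unfolded v1' v2']) simp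
  then have 2: "det2 v1 v2 = x2 * \<delta>" using on_l[OF D] by simp
  \<comment> \<open>As \<open>Q\<close> lies on the ray and not merely on its line,
    \<open>\<delta>\<close> has the sign of \<open>det2 v1 v2\<close>; this fixes the sign of
    \<open>x2\<close>.\<close>
  have "r * n * (det2 v1 v2 * det2 v1 v2) \<ge> 0" using r n by simp
  then have "\<delta> * det2 v1 v2 \<ge> 0" unfolding 1[symmetric] by (simp only: mult.assoc)
  then show "x2 = \<bar>det2 v1 v2\<bar>" using 2 \<delta> by (auto simp: abs_if split: if_splits)
qed

section \<open>The continued fraction of an irrational slope\<close>

primrec complete_quotient :: "real \<Rightarrow> nat \<Rightarrow> real" where
  "complete_quotient s 0 = s"
| "complete_quotient s (Suc n) = 1 / frac (complete_quotient s n)"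

definition partial_quotient :: "real \<Rightarrow> nat \<Rightarrow> int" where
  "partial_quotient s n = \<lfloor>complete_quotient s n\<rfloor>"

text \<open>With the convergents $p_n / q_n$ of \<open>s\<close> in the usual numbering, \<open>convergent_vec s (n + 2)\<close> is
  $(q_n, p_n)$.\<close>

fun convergent_vec :: "real \<Rightarrow> nat \<Rightarrow> real^2" where
  "convergent_vec s 0 = vector [1, 0]"
| "convergent_vec s (Suc 0) = vector [0, 1]"
| "convergent_vec s (Suc (Suc n)) =
     convergent_vec s n + of_int (partial_quotient s n) *\<^sub>R convergent_vec s (Suc n)"

text \<open>Merging the last two entries shortens the list from the right, which the recursion of
  \<open>cfrac\<close> from the left does not offer.\<close>

lemma cfrac_snoc2: "cfrac (xs @ [a, x]) = cfrac (xs @ [a + 1 / x])"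
proof (induction xs)
  case (Cons c xs)
  then show ?case by (cases xs) auto
qed simp

locale irrational_slope =
  fixes s :: real
  assumes irrational: "s \<notin> \<rat>" and gt_1: "s > 1"
begin

abbreviation "x \<equiv> complete_quotient s"
abbreviation "a \<equiv> partial_quotient s"
abbreviation "P \<equiv> convergent_vec s"

lemma complete_quotient: "x n \<notin> \<rat> \<and> x n > 1"
proof (induction n)
  case 0
  then show ?case using irrational gt_1 by simp
next
  case (Suc n)
  have f: "frac (x n) \<notin> \<rat>" using Suc unfolding frac_def
    by (metis Rats_add Rats_of_int diff_add_cancel)
  then have "frac (x n) \<noteq> 0" by (metis Rats_0)
  then have "frac (x n) > 0" "frac (x n) < 1" using frac_ge_0[of "x n"] frac_lt_1[of "x n"] by linarith+
  moreover have "1 / frac (x n) \<notin> \<rat>"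
    using f by (metis Rats_divide Rats_1 divide_divide_eq_right div_by_1 mult_1)
  ultimately show ?case by simp
qed

lemma partial_quotient_ge_1: "a n \<ge> 1"
  using complete_quotient[of n] by (simp add: partial_quotient_def le_floor_iff)

lemma real_partial_quotient_ge_1: "real_of_int (a n) \<ge> 1"
  using partial_quotient_ge_1[of n] by simp

lemma complete_quotient_rec: "x n = a n + 1 / x (Suc n)"
  by (simp add: partial_quotient_def frac_def)

lemma convergent_vec_in_int_lattice: "P n \<in> int_lattice"
  by (induction s n rule: convergent_vec.induct) auto

lemma det2_convergent_vec: "det2 (P n) (P (Suc n)) = (- 1) ^ n"
proof (induction n)
  case (Suc n)
  then show ?case using det2_swap[of "P (Suc n)" "P n"] by simp
qed (simp add: det2_def)

lemma convergent_vec_nonneg: "P n $ 1 \<ge> 0 \<and> P n $ 2 \<ge> 0"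
proof (induction n rule: less_induct)
  case (less n)
  consider "n = 0" | "n = 1" | m where "n = Suc (Suc m)" by (metis One_nat_def not0_implies_Suc)
  then show ?case
  proof cases
    case (3 m)
    then show ?thesis using less[of m] less[of "Suc m"] real_partial_quotient_ge_1[of m] by simp
  qed auto
qed

lemma convergent_vec_1_ge_1: "n \<noteq> 1 \<Longrightarrow> P n $ 1 \<ge> 1"
proof (induction n rule: less_induct)
  case (less n)
  \<comment> \<open>Index 3 is separate because its recursion starts from
    \<open>P 1 = (0, 1)\<close>; the lower bound there comes from the multiple of \<open>P 2\<close>
    instead.\<close>
  consider "n = 0" | m where "n = Suc (Suc m)" "m \<noteq> 1" | "n = 3"
    using less.prems by (metis One_nat_def not0_implies_Suc numeral_3_eq_3)
  then show ?case
  proof cases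
    case (2 m)
    then have "P m $ 1 \<ge> 1" using less.IH[of m] by simp
    moreover have "of_int (a m) * P (Suc m) $ 1 \<ge> 0"
      using convergent_vec_nonneg[of "Suc m"] real_partial_quotient_ge_1[of m] by simp
    ultimately show ?thesis using 2 by simp
  next
    case 3
    then show ?thesis using real_partial_quotient_ge_1[of "Suc 0"] by (simp add: numeral_3_eq_3)
  qed auto
qed

lemma convergent_vec_2_ge_1: "n \<noteq> 0 \<Longrightarrow> P n $ 2 \<ge> 1"
proof (induction n rule: less_induct)
  case (less n)
  consider "n = 1" | m where "n = Suc (Suc m)"
    using less.prems by (metis One_nat_def not0_implies_Suc)
  then show ?case
  proof cases
    case (2 m)
    then have "P (Suc m) $ 2 \<ge> 1" using less.IH[of "Suc m"] by simp
    then have "of_int (a m) * P (Suc m) $ 2 \<ge> 1 * 1"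
      using real_partial_quotient_ge_1[of m] by (intro mult_mono) auto
    then show ?thesis using 2 convergent_vec_nonneg[of m] by simp
  qed auto
qed

text \<open>A crude linear growth of the denominators, enough to drive the error of the convergents
  to 0.\<close>

lemma convergent_vec_1_ge: "P (n + 2) $ 1 \<ge> real n"
proof (induction n)
  case (Suc n)
  have *: "of_int (a (Suc n)) * P (n + 2) $ 1 \<ge> 1 * P (n + 2) $ 1"
    using convergent_vec_nonneg[of "n + 2"] real_partial_quotient_ge_1[of "Suc n"]
    by (intro mult_right_mono) auto
  show ?case
  proof (cases "n = 0")
    case True
    then show ?thesis using convergent_vec_1_ge_1[of 3] by (simp add: numeral_3_eq_3)
  next
    case False
    then have "P (Suc n) $ 1 \<ge> 1" using convergent_vec_1_ge_1 by simp
    moreover have "P (Suc n + 2) $ 1 = P (Suc n) $ 1 + of_int (a (Suc n)) * P (n + 2) $ 1" by simp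
    ultimately show ?thesis using Suc * by linarith
  qed
qed (use convergent_vec_nonneg in auto)

text \<open>The classical expression of \<open>s\<close> as a fractional linear function of its
  complete quotient, in homogeneous form: \<open>c\<close> absorbs the denominator, and the step
  substitutes \<open>x n = a n + 1 / x (Suc n)\<close>.\<close>

lemma slope_vec_combination:
  "\<exists>c>0. vector [1, s] = c *\<^sub>R (P n + x n *\<^sub>R P (Suc n))"
proof (induction n)
  case 0
  have "vector [1, s] = 1 *\<^sub>R (P 0 + x 0 *\<^sub>R P (Suc 0))"
    by (intro vec2_eqI) auto
  then show ?case using zero_less_one by blast
next
  case (Suc n)
  then obtain c where c: "c > 0" "vector [1, s] = c *\<^sub>R (P n + x n *\<^sub>R P (Suc n))" by auto
  have x: "x (Suc n) > 1" using complete_quotient[of "Suc n"] by auto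
  have "vector [1, s] = c *\<^sub>R (P n + (a n + 1 / x (Suc n)) *\<^sub>R P (Suc n))"
    unfolding complete_quotient_rec[symmetric] by (rule c(2))
  also have "\<dots> = (c / x (Suc n)) *\<^sub>R (P (Suc n) + x (Suc n) *\<^sub>R P (Suc (Suc n)))"
    using x unfolding convergent_vec.simps by (simp add: algebra_simps del: complete_quotient.simps)
  finally have "vector [1, s] = (c / x (Suc n)) *\<^sub>R (P (Suc n) + x (Suc n) *\<^sub>R P (Suc (Suc n)))" .
  moreover have "c / x (Suc n) > 0" using c(1) order_less_trans[OF zero_less_one x] by (rule divide_pos_pos)
  ultimately show ?case by blast
qed

lemma det2_slope_vec: "det2 p (vector [1, s]) = s * p $ 1 - p $ 2"
  by (simp add: det2_def)

text \<open>Pairing \<open>P n\<close> with the decomposition of \<open>(1, s)\<close> leaves only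
  the term of \<open>P (Suc n)\<close>, so the error is exactly \<open>c * x n\<close> with
  alternating sign. The first coordinate of the same decomposition bounds that product.\<close>

lemma convergent_vec_side: "(- 1) ^ n * (s * P n $ 1 - P n $ 2) > 0"
  and convergent_vec_error: "\<bar>s * P n $ 1 - P n $ 2\<bar> * P (Suc n) $ 1 \<le> 1"
proof -
  obtain c where c: "c > 0" "vector [1, s] = c *\<^sub>R (P n + x n *\<^sub>R P (Suc n))"
    using slope_vec_combination by blast
  have x: "x n > 1" using complete_quotient[of n] by simp
  have e: "s * P n $ 1 - P n $ 2 = c * x n * (- 1) ^ n"
    unfolding det2_slope_vec[symmetric] c(2) by (simp add: det2_convergent_vec)
  have "(- 1) ^ n * (c * x n * (- 1) ^ n) = c * x n * ((- 1) ^ n * (- 1) ^ n)" by simp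
  also have "\<dots> = c * x n" by (simp flip: power_mult_distrib)
  finally have *: "(- 1) ^ n * (c * x n * (- 1) ^ n) = c * x n" .
  show "(- 1) ^ n * (s * P n $ 1 - P n $ 2) > 0" unfolding e * using c(1) x by simp
  have "1 = c * P n $ 1 + c * x n * P (Suc n) $ 1"
    using arg_cong[OF c(2), of "\<lambda>v. v $ 1"] by (simp add: algebra_simps)
  moreover have "c * P n $ 1 \<ge> 0" using c(1) convergent_vec_nonneg[of n] by simp
  ultimately have "c * x n * P (Suc n) $ 1 \<le> 1" by linarith
  moreover have "\<bar>c * x n * (- 1) ^ n\<bar> = c * x n" using c(1) x by (simp add: abs_mult power_abs)
  ultimately show "\<bar>s * P n $ 1 - P n $ 2\<bar> * P (Suc n) $ 1 \<le> 1" unfolding e by simp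
qed

lemma convergents_tendsto: "(\<lambda>n. P (n + 2) $ 2 / P (n + 2) $ 1) \<longlonglongrightarrow> s"
proof -
  have "norm (P (n + 2) $ 2 / P (n + 2) $ 1 - s) \<le> inverse (real (Suc n))" for n
  proof -
    have q: "P (n + 2) $ 1 \<ge> 1" using convergent_vec_1_ge_1[of "n + 2"] by simp
    have q': "P (Suc (n + 2)) $ 1 \<ge> real (Suc n)" using convergent_vec_1_ge[of "Suc n"] by simp
    define e where "e = \<bar>s * P (n + 2) $ 1 - P (n + 2) $ 2\<bar>"
    have "P (n + 2) $ 2 / P (n + 2) $ 1 - s = (P (n + 2) $ 2 - s * P (n + 2) $ 1) / P (n + 2) $ 1"
      using q by (simp add: field_simps del: convergent_vec.simps)
    then have "norm (P (n + 2) $ 2 / P (n + 2) $ 1 - s) = e / P (n + 2) $ 1"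
      using q by (simp add: e_def abs_minus_commute del: convergent_vec.simps)
    also have "\<dots> \<le> e / 1" using q by (intro divide_left_mono) (auto simp: e_def)
    also have "e * real (Suc n) \<le> e * P (Suc (n + 2)) $ 1"
      using q' by (intro mult_left_mono) (auto simp: e_def)
    then have "e * real (Suc n) \<le> 1" using convergent_vec_error[of "n + 2"] unfolding e_def by linarith
    then have "e / 1 \<le> inverse (real (Suc n))" by (simp add: field_simps)
    finally show ?thesis .
  qed
  then have "(\<lambda>n. P (n + 2) $ 2 / P (n + 2) $ 1 - s) \<longlonglongrightarrow> 0"
    by (intro Lim_null_comparison[OF _ LIMSEQ_inverse_real_of_nat] always_eventually allI)
  then show ?thesis by (simp add: LIM_zero_iff)
qed

text \<open>The last entry is an arbitrary positive real so that the induction can merge it into its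
  predecessor; \<open>y = a n\<close> then yields the convergents.\<close>

lemma cfrac_partial_quotients:
  assumes "y > 0"
  shows "cfrac (map (\<lambda>i. of_int (a i)) [0..<n] @ [y]) =
    (P n $ 2 + y * P (Suc n) $ 2) / (P n $ 1 + y * P (Suc n) $ 1)"
  using assms
proof (induction n arbitrary: y)
  case (Suc n)
  have "cfrac (map (\<lambda>i. of_int (a i)) [0..<Suc n] @ [y])
      = cfrac (map (\<lambda>i. of_int (a i)) [0..<n] @ [a n + 1 / y])"
    using cfrac_snoc2[of "map (\<lambda>i. real_of_int (a i)) [0..<n]" "a n" y] by simp
  also have "\<dots> = (P n $ 2 + (a n + 1 / y) * P (Suc n) $ 2) / (P n $ 1 + (a n + 1 / y) * P (Suc n) $ 1)"
    using Suc.prems real_partial_quotient_ge_1[of n] by (intro Suc.IH) (simp add: add_pos_pos)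
  also have "\<dots> = (y * (P n $ 2 + (a n + 1 / y) * P (Suc n) $ 2)) / (y * (P n $ 1 + (a n + 1 / y) * P (Suc n) $ 1))"
    using Suc.prems by simp
  also have "y * (P n $ 2 + (a n + 1 / y) * P (Suc n) $ 2) = P (Suc n) $ 2 + y * P (Suc (Suc n)) $ 2"
    using Suc.prems by (simp add: field_simps)
  also have "y * (P n $ 1 + (a n + 1 / y) * P (Suc n) $ 1) = P (Suc n) $ 1 + y * P (Suc (Suc n)) $ 1"
    using Suc.prems by (simp add: field_simps)
  finally show ?case .
qed simp

lemma infinite_cfrac_partial_quotient: "infinite_cfrac (\<lambda>i. of_int (a i)) = s"
proof -
  have "cfrac (map (\<lambda>i. of_int (a i)) [0..<Suc k]) = P (k + 2) $ 2 / P (k + 2) $ 1" for k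
    using cfrac_partial_quotients[of "of_int (a k)" k] real_partial_quotient_ge_1[of k] by simp
  then show ?thesis unfolding infinite_cfrac_def using limI[OF convergents_tendsto] by simp
qed

end

section \<open>The sail of the standard angle\<close>

lemma ray_multiple: "t \<ge> 0 \<Longrightarrow> t *\<^sub>R v \<in> ray 0 v"
  by (auto simp: ray_def)

text \<open>The extremal principle behind the vertex and adjacency arguments: a functional that
  attains its lower bound strictly inside a segment attains it at both ends.\<close>

lemma convex_combination_min:
  fixes u x y m :: real
  assumes "0 < u" "u < 1" "(1 - u) * x + u * y = m" "x \<ge> m" "y \<ge> m"
  shows "x = m" "y = m"
proof -
  have "(1 - u) * (x - m) + u * (y - m) = 0" using assms(3) by (simp add: algebra_simps)
  moreover have "(1 - u) * (x - m) \<ge> 0" "u * (y - m) \<ge> 0" using assms by auto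
  ultimately have "(1 - u) * (x - m) = 0" "u * (y - m) = 0" by linarith+
  then show "x = m" "y = m" using assms(1,2) by auto
qed

context irrational_slope
begin

section \<open>Even and odd convergent vectors\<close>

definition V :: "nat \<Rightarrow> real^2" where "V k = P (2 * k)"
definition W :: "nat \<Rightarrow> real^2" where "W k = P (2 * k + 1)"

lemma V_0: "V 0 = vector [1, 0]" by (simp add: V_def)

lemma V_Suc: "V (Suc k) = V k + of_int (a (2 * k)) *\<^sub>R W k"
  and W_Suc: "W (Suc k) = W k + of_int (a (2 * k + 1)) *\<^sub>R V (Suc k)"
  by (simp_all add: V_def W_def)

lemma V_in_int_lattice: "V k \<in> int_lattice" and W_in_int_lattice: "W k \<in> int_lattice"
  by (simp_all add: V_def W_def convergent_vec_in_int_lattice del: convergent_vec.simps)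

lemma det2_V_W: "det2 (V k) (W k) = 1"
  using det2_convergent_vec[of "2 * k"] by (simp add: V_def W_def)

lemma det2_V_Suc_W: "det2 (V (Suc k)) (W k) = 1"
  by (simp add: V_Suc det2_V_W)

lemma V_below: "V k $ 2 < s * V k $ 1"
  using convergent_vec_side[of "2 * k"] by (simp add: V_def)

lemma W_above: "s * W k $ 1 < W k $ 2"
  using convergent_vec_side[of "2 * k + 1"] by (simp add: W_def)

lemma V_nonneg: "V k $ 2 \<ge> 0"
  using convergent_vec_nonneg[of "2 * k"] by (simp add: V_def)

lemma V_1_ge_1: "V k $ 1 \<ge> 1"
  using convergent_vec_1_ge_1[of "2 * k"] by (simp add: V_def)

lemma W_nonneg: "W k $ 1 \<ge> 0"
  using convergent_vec_nonneg[of "2 * k + 1"] by (simp add: W_def)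

text \<open>The second coordinate serves as a height. Steps of at least 1 give injectivity of
  \<open>V\<close>, local finiteness of the broken line and the fact that only \<open>V 0\<close>
  has height 0.\<close>

lemma V_2_Suc: "V (Suc k) $ 2 \<ge> V k $ 2 + 1"
proof -
  have "W k $ 2 \<ge> 1" using convergent_vec_2_ge_1[of "2 * k + 1"] by (simp add: W_def)
  then have "of_int (a (2 * k)) * W k $ 2 \<ge> 1 * 1"
    using real_partial_quotient_ge_1[of "2 * k"] by (intro mult_mono) auto
  then show ?thesis by (simp add: V_Suc)
qed

lemma V_2_ge: "V k $ 2 \<ge> real k"
proof (induction k)
  case (Suc k)
  then show ?case using V_2_Suc[of k] by simp
qed (simp add: V_0)

lemma strict_mono_V: "strict_mono (\<lambda>k. V k $ 2)"
  using V_2_Suc by (intro strict_monoI_Suc) (smt (verit))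

lemma inj_V: "inj V"
proof (rule injI)
  fix i j assume "V i = V j"
  then show "i = j" using strict_mono_eq[OF strict_mono_V, of i j] by simp
qed

text \<open>The recursions of \<open>V\<close> and \<open>W\<close> feed each other, so both bounds
  are proved together. The growing term keeps the vertices after \<open>V (Suc k)\<close> off the
  line of edge \<open>k\<close>.\<close>

lemma det2_V_W_after:
  "det2 (V (Suc k + m)) (W k) \<ge> 1 + real m \<and> det2 (W (Suc k + m)) (W k) \<ge> 1"
proof (induction m)
  case 0
  then show ?case using real_partial_quotient_ge_1[of "2 * k + 1"]
    by (simp add: det2_V_Suc_W W_Suc del: of_int_1_le_iff)
next
  case (Suc m)
  let ?i = "Suc k + m"
  have "of_int (a (2 * ?i)) * det2 (W ?i) (W k) \<ge> 1 * 1"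
    using Suc real_partial_quotient_ge_1[of "2 * ?i"] by (intro mult_mono) auto
  then have 1: "det2 (V (Suc ?i)) (W k) \<ge> 1 + real (Suc m)"
    using Suc unfolding V_Suc[of ?i] by simp
  then have "of_int (a (2 * ?i + 1)) * det2 (V (Suc ?i)) (W k) \<ge> 0"
    using real_partial_quotient_ge_1[of "2 * ?i + 1"] by (intro mult_nonneg_nonneg) auto
  then have "det2 (W (Suc ?i)) (W k) \<ge> 1"
    using Suc unfolding W_Suc[of ?i] by simp
  then show ?case using 1 by simp
qed

text \<open>The counterpart for vertices before edge \<open>k\<close>: here the vertex is fixed and
  the index of the edge grows.\<close>

lemma det2_V_W_before:
  "det2 (V i) (W (i + m)) \<ge> 1 + real m \<and> det2 (V i) (V (i + m)) \<ge> 0"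
proof (induction m)
  case 0
  then show ?case by (simp add: det2_V_W)
next
  case (Suc m)
  let ?k = "i + m"
  have "of_int (a (2 * ?k)) * det2 (V i) (W ?k) \<ge> 1 * 1"
    using Suc real_partial_quotient_ge_1[of "2 * ?k"] by (intro mult_mono) auto
  then have 1: "det2 (V i) (V (Suc ?k)) \<ge> 1"
    using Suc unfolding V_Suc[of ?k] by simp
  then have "of_int (a (2 * ?k + 1)) * det2 (V i) (V (Suc ?k)) \<ge> 1 * 1"
    using real_partial_quotient_ge_1[of "2 * ?k + 1"] by (intro mult_mono) auto
  then have "det2 (V i) (W (Suc ?k)) \<ge> 1 + real (Suc m)"
    using Suc unfolding W_Suc[of ?k] by simp
  then show ?case using 1 by simp
qed

lemma det2_V_W_eq_1: "det2 (V i) (W k) = 1 \<Longrightarrow> i = k \<or> i = Suc k"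
proof -
  assume *: "det2 (V i) (W k) = 1"
  consider "i \<le> k" | "i \<ge> Suc k" by linarith
  then show ?thesis
  proof cases
    case 1
    then show ?thesis using * det2_V_W_before[where i = i and m = "k - i"] by simp
  next
    case 2
    then show ?thesis using * det2_V_W_after[where k = k and m = "i - Suc k"] by simp
  qed
qed

section \<open>The cone, the hull of its lattice points and the broken line\<close>

definition wedge :: "(real^2) set" where
  "wedge = {p. 0 \<le> p $ 2 \<and> p $ 2 \<le> s * p $ 1}"

definition open_wedge :: "(real^2) set" where
  "open_wedge = {p. 0 < p $ 2 \<and> p $ 2 < s * p $ 1}"

definition H :: "(real^2) set" where
  "H = convex hull (wedge \<inter> int_lattice - {0})"

definition broken_line :: "(real^2) set" where
  "broken_line = (\<Union>k. closed_segment (V k) (V (Suc k)))"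

lemma angle_cone_larctan: "angle_cone (larctan s) = wedge"
proof
  have "convex wedge" unfolding wedge_def
  proof (rule convexI, goal_cases)
    case (1 p q u v)
    then have "0 \<le> u * p $ 2 + v * q $ 2" by simp
    moreover have "u * p $ 2 + v * q $ 2 \<le> u * (s * p $ 1) + v * (s * q $ 1)"
      using 1 by (intro add_mono mult_left_mono) auto
    ultimately show ?case by (simp add: algebra_simps)
  qed
  moreover have "ray 0 (vector [1, 0]) \<union> ray 0 (vector [1, s]) \<subseteq> wedge"
    using gt_1 by (auto simp: ray_def wedge_def)
  ultimately show "angle_cone (larctan s) \<subseteq> wedge"
    unfolding angle_cone_def larctan_def angle_of_def by (simp add: hull_minimal)
next
  show "wedge \<subseteq> angle_cone (larctan s)"
  proof
    fix p assume "p \<in> wedge"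
    then have p: "0 \<le> p $ 2" "p $ 2 / s \<le> p $ 1" using gt_1 by (auto simp: wedge_def field_simps)
    \<comment> \<open>\<open>p\<close> is \<open>(p $ 1 - b) (1, 0) + b (1, s)\<close>; both
      summands are doubled so that \<open>p\<close> becomes the midpoint of a point on each
      ray.\<close>
    define b where "b = p $ 2 / s"
    define u where "u = (2 * (p $ 1 - b)) *\<^sub>R (vector [1, 0] :: real^2)"
    define v where "v = (2 * b) *\<^sub>R (vector [1, s] :: real^2)"
    have "u \<in> ray 0 (vector [1, 0])" "v \<in> ray 0 (vector [1, s])"
      unfolding u_def v_def using p gt_1 by (auto simp: b_def intro!: ray_multiple)
    then have uv: "u \<in> angle_cone (larctan s)" "v \<in> angle_cone (larctan s)"
      unfolding angle_cone_def larctan_def angle_of_def by (simp_all add: hull_inc)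
    have "(1/2) *\<^sub>R u + (1/2) *\<^sub>R v \<in> angle_cone (larctan s)"
      using uv by (intro convexD) (auto simp: angle_cone_def)
    also have "(1/2) *\<^sub>R u + (1/2) *\<^sub>R v = p"
      using gt_1 by (intro vec2_eqI) (auto simp: u_def v_def b_def field_simps)
    finally show "p \<in> angle_cone (larctan s)" .
  qed
qed

lemma interior_wedge: "interior wedge = open_wedge"
proof -
  have *: "wedge = {p. p $ 2 \<ge> 0} \<inter> {p. vector [s, -1] \<bullet> p \<ge> 0}"
    by (auto simp: wedge_def inner_vec_def sum_2)
  have "(vector [s, -1] :: real^2) \<noteq> 0" by (simp add: vec_eq_iff forall_2)
  then have "interior wedge = {p. p $ 2 > 0} \<inter> {p. vector [s, -1] \<bullet> p > 0}"
    unfolding * interior_Int by simp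
  then show ?thesis by (auto simp: open_wedge_def inner_vec_def sum_2)
qed

lemma open_open_wedge: "open open_wedge"
  using interior_wedge open_interior by metis

lemma V_in_wedge: "V k \<in> wedge"
  using V_below[of k] V_nonneg[of k] by (simp add: wedge_def)

lemma V_nonzero: "V k \<noteq> 0"
  using V_1_ge_1[of k] by auto

lemma det2_W_pos:
  assumes "p \<in> wedge" "p \<noteq> 0"
  shows "det2 p (W k) > 0"
proof -
  have p: "0 \<le> p $ 2" "p $ 2 \<le> s * p $ 1" using assms(1) by (auto simp: wedge_def)
  have "p $ 1 > 0"
  proof (rule ccontr)
    assume "\<not> p $ 1 > 0"
    then have "s * p $ 1 \<le> s * 0" using gt_1 by (intro mult_left_mono) auto
    then have "s * p $ 1 = 0" "p $ 2 = 0" using p by linarith+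
    then have "p = 0" using gt_1 by (intro vec2_eqI) auto
    then show False using assms(2) by simp
  qed
  then have "p $ 1 * (s * W k $ 1) < p $ 1 * W k $ 2" using W_above by simp
  moreover have "p $ 2 * W k $ 1 \<le> s * p $ 1 * W k $ 1"
    using p W_nonneg[of k] by (intro mult_right_mono) auto
  ultimately show ?thesis unfolding det2_def by (simp add: algebra_simps)
qed

lemma det2_W_ge_1:
  assumes "p \<in> wedge \<inter> int_lattice - {0}"
  shows "det2 p (W k) \<ge> 1"
proof -
  have "det2 p (W k) \<in> \<int>" using assms W_in_int_lattice by (intro det2_in_Ints) auto
  then obtain i where i: "det2 p (W k) = of_int i" by (rule Ints_cases)
  have "det2 p (W k) > 0" using assms det2_W_pos by blast
  then show ?thesis unfolding i by simp
qed

lemma H_halfplane: "H \<subseteq> {p. det2 p (W k) \<ge> 1}"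
  unfolding H_def
proof (rule hull_minimal)
  show "wedge \<inter> int_lattice - {0} \<subseteq> {p. det2 p (W k) \<ge> 1}" using det2_W_ge_1 by blast
  show "convex {p. det2 p (W k) \<ge> 1}"
  proof (rule convexI, goal_cases)
    case (1 p q u v)
    then have "u * 1 + v * 1 \<le> u * det2 p (W k) + v * det2 q (W k)"
      by (intro add_mono mult_left_mono) auto
    then show ?case using 1 by simp
  qed
qed

lemma convex_H: "convex H" by (simp add: H_def)

lemma V_in_H: "V k \<in> H"
  unfolding H_def using V_in_wedge V_in_int_lattice V_nonzero by (intro hull_inc) auto

text \<open>Translation by an integer multiple of \<open>V k\<close> maps the generating lattice
  points into themselves, hence \<open>H\<close> into itself. A real multiple \<open>t\<close> is
  reached by convexity, between \<open>p\<close> and its translate by a larger integer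
  multiple.\<close>

lemma H_plus_V:
  assumes "p \<in> H" "t \<ge> 0"
  shows "p + t *\<^sub>R V k \<in> H"
proof -
  obtain n :: nat where n: "real n > t" using reals_Archimedean2 by blast
  then have n0: "real n > 0" using assms(2) by linarith
  let ?S = "wedge \<inter> int_lattice - {0}"
  have "(+) (real n *\<^sub>R V k) ` ?S \<subseteq> ?S"
  proof (rule image_subsetI)
    fix q assume q: "q \<in> ?S"
    have "real n *\<^sub>R V k + q \<in> wedge"
    proof -
      have "real n * V k $ 2 \<le> real n * (s * V k $ 1)" using V_below[of k] n0 by simp
      moreover have "real n * V k $ 2 \<ge> 0" using V_nonneg[of k] n0 by simp
      ultimately show ?thesis using q by (auto simp: wedge_def algebra_simps)
    qed
    moreover have "det2 (real n *\<^sub>R V k + q) (W k) > 0"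
      using det2_W_ge_1[OF q, of k] n0 by (simp add: det2_V_W)
    then have "real n *\<^sub>R V k + q \<noteq> 0" by (metis det2_simps(10) less_irrefl)
    ultimately show "real n *\<^sub>R V k + q \<in> ?S" using q V_in_int_lattice by simp
  qed
  then have "convex hull ((+) (real n *\<^sub>R V k) ` ?S) \<subseteq> H" unfolding H_def by (rule hull_mono)
  then have "real n *\<^sub>R V k + p \<in> H"
    using assms(1) unfolding convex_hull_translation H_def by blast
  then have "(1 - t / n) *\<^sub>R p + (t / n) *\<^sub>R (real n *\<^sub>R V k + p) \<in> H"
    using assms n n0 by (intro convexD[OF convex_H]) (auto simp: field_simps)
  also have "(1 - t / n) *\<^sub>R p + (t / n) *\<^sub>R (real n *\<^sub>R V k + p) = p + t *\<^sub>R V k"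
    using n0 by (simp add: algebra_simps)
  finally show ?thesis .
qed

text \<open>Convergence of the slopes puts some \<open>V (Suc k)\<close> on or past the direction of
  \<open>p\<close>. For the least such \<open>k\<close>, \<open>V k\<close> is not past it, so
  Cramer's rule gives nonnegative coefficients.\<close>

lemma subcone_decomposition:
  assumes "0 \<le> p $ 2" "p $ 2 < s * p $ 1"
  obtains k \<alpha> \<beta> where "\<alpha> \<ge> 0" "\<beta> \<ge> 0" "p = \<alpha> *\<^sub>R V k + \<beta> *\<^sub>R V (Suc k)"
proof -
  have p1: "p $ 1 > 0" using assms gt_1
    by (metis less_trans order_le_less_trans zero_less_mult_pos zero_less_one)
  then have "p $ 2 / p $ 1 < s" using assms(2) by (simp add: field_simps)
  then have "eventually (\<lambda>n. p $ 2 / p $ 1 < P (n + 2) $ 2 / P (n + 2) $ 1) sequentially"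
    using convergents_tendsto by (rule order_tendstoD(1)[rotated])
  then obtain N where N: "p $ 2 / p $ 1 < P (n + 2) $ 2 / P (n + 2) $ 1" if "n \<ge> N" for n
    unfolding eventually_sequentially by blast
  have "p $ 2 / p $ 1 < V (Suc N) $ 2 / V (Suc N) $ 1" using N[of "2 * N"] by (simp add: V_def)
  then have "det2 p (V (Suc N)) \<ge> 0"
    using p1 V_1_ge_1[of "Suc N"] by (simp add: det2_def field_simps)
  then have ex: "\<exists>k. det2 p (V (Suc k)) \<ge> 0" by blast
  define k where "k = (LEAST k. det2 p (V (Suc k)) \<ge> 0)"
  have 1: "det2 p (V (Suc k)) \<ge> 0" unfolding k_def by (rule LeastI_ex[OF ex])
  have 2: "det2 (V k) p \<ge> 0"
  proof (cases k)
    case 0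
    then show ?thesis using assms(1) by (simp add: V_0 det2_def)
  next
    case (Suc j)
    then have "\<not> det2 p (V (Suc j)) \<ge> 0" unfolding k_def by (intro not_less_Least) simp
    then show ?thesis using Suc det2_swap[of "V k" p] by simp
  qed
  define d where "d = det2 (V k) (V (Suc k))"
  have d: "d > 0" using real_partial_quotient_ge_1[of "2 * k"]
    by (simp add: d_def V_Suc det2_V_W del: of_int_1_le_iff)
  have "p = (1 / d) *\<^sub>R (d *\<^sub>R p)" using d by simp
  also have "d *\<^sub>R p = det2 p (V (Suc k)) *\<^sub>R V k + det2 (V k) p *\<^sub>R V (Suc k)"
    unfolding d_def by (rule det2_cramer)
  finally have "p = (det2 p (V (Suc k)) / d) *\<^sub>R V k + (det2 (V k) p / d) *\<^sub>R V (Suc k)"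
    by (simp add: scaleR_add_right)
  then show thesis using 1 2 d by (intro that) auto
qed

text \<open>Supplies an open set of points of \<open>H\<close> beyond each point of
  \<open>H\<close>, which is how points are shown to be interior.\<close>

lemma H_plus_open_wedge:
  assumes "p \<in> H" "c \<in> open_wedge"
  shows "p + c \<in> H"
proof -
  obtain k \<alpha> \<beta> where "\<alpha> \<ge> 0" "\<beta> \<ge> 0" "c = \<alpha> *\<^sub>R V k + \<beta> *\<^sub>R V (Suc k)"
    using assms(2) unfolding open_wedge_def
    by (metis (mono_tags, lifting) less_imp_le mem_Collect_eq subcone_decomposition)
  then show ?thesis using H_plus_V[OF H_plus_V[OF assms(1)], of \<alpha> \<beta> k "Suc k"] by (simp add: add.assoc)
qed

lemma segment_in_H: "closed_segment (V k) (V (Suc k)) \<subseteq> H"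
  by (intro closed_segment_subset V_in_H convex_H)

lemma det2_W_segment: "p \<in> closed_segment (V k) (V (Suc k)) \<Longrightarrow> det2 p (W k) = 1"
  by (auto simp: in_segment det2_V_W det2_V_Suc_W)

lemma segment_in_open_wedge:
  assumes p: "p \<in> closed_segment (V k) (V (Suc k))" and "p \<noteq> V 0"
  shows "p \<in> open_wedge"
proof -
  obtain u where u: "0 \<le> u" "u \<le> 1" "p = (1 - u) *\<^sub>R V k + u *\<^sub>R V (Suc k)"
    using p by (auto simp: in_segment)
  have "(1 - u) * V k $ 2 + u * V (Suc k) $ 2 < (1 - u) * (s * V k $ 1) + u * (s * V (Suc k) $ 1)"
  proof (cases "u = 0")
    case False
    then show ?thesis using u V_below[of k] V_below[of "Suc k"]
      by (intro add_le_less_mono mult_left_mono mult_strict_left_mono) auto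
  qed (simp add: V_below)
  then have "p $ 2 < s * p $ 1" unfolding u(3) by (simp add: algebra_simps)
  moreover have "p $ 2 > 0"
  proof (cases "u = 0")
    case True
    then have "k \<noteq> 0" using u assms(2) by (cases k) auto
    then have "V k $ 2 > 0" using V_2_ge[of k] by linarith
    then show ?thesis using True u by simp
  next
    case False
    have "(1 - u) * V k $ 2 \<ge> 0" using u V_nonneg[of k] by simp
    moreover have "u * V (Suc k) $ 2 > 0" using u False V_2_ge[of "Suc k"] by simp
    ultimately show ?thesis using u by simp
  qed
  ultimately show ?thesis by (simp add: open_wedge_def)
qed

lemma V_0_notin_open_wedge: "V 0 \<notin> open_wedge"
  by (simp add: open_wedge_def V_0)

text \<open>A point strictly beyond its edge is an edge point plus a vector of the open cone, hence
  interior to \<open>H\<close>. A point of an edge is not interior, since moving it toward the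
  origin leaves the supporting half-plane.\<close>

lemma frontier_H_Int_open_wedge: "frontier H \<inter> open_wedge = broken_line - {V 0}"
proof (intro equalityI subsetI)
  fix p assume p: "p \<in> frontier H \<inter> open_wedge"
  then obtain k \<alpha> \<beta> where ab: "\<alpha> \<ge> 0" "\<beta> \<ge> 0" "p = \<alpha> *\<^sub>R V k + \<beta> *\<^sub>R V (Suc k)"
    unfolding open_wedge_def
    by (metis (mono_tags, lifting) IntD2 less_imp_le mem_Collect_eq subcone_decomposition)
  have "closed {p. det2 p (W k) \<ge> 1}"
    unfolding det2_def by (intro closed_Collect_le continuous_intros)
  then have "closure H \<subseteq> {p. det2 p (W k) \<ge> 1}" using H_halfplane by (rule closure_minimal[rotated])
  then have ge: "\<alpha> + \<beta> \<ge> 1" using p ab by (auto simp: frontier_def det2_V_W det2_V_Suc_W)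
  \<comment> \<open>Both ends of the edge have value 1 under \<open>W k\<close>, so \<open>t\<close>
    is \<open>det2 p (W k)\<close>, and dividing by it projects \<open>p\<close> radially onto the
    edge.\<close>
  define t where "t = \<alpha> + \<beta>"
  define p0 where "p0 = (1 / t) *\<^sub>R p"
  have "p0 = (1 - \<beta> / t) *\<^sub>R V k + (\<beta> / t) *\<^sub>R V (Suc k)"
    using ge ab unfolding p0_def t_def by (simp add: scaleR_add_right field_simps)
  then have p0: "p0 \<in> closed_segment (V k) (V (Suc k))"
    unfolding in_segment using ge ab by (intro exI[of _ "\<beta> / t"]) (auto simp: t_def)
  have "t = 1"
  proof (rule ccontr)
    assume "t \<noteq> 1"
    then have t: "t > 1" using ge by (simp add: t_def)
    have "(+) p0 ` open_wedge \<subseteq> H" using H_plus_open_wedge p0 segment_in_H by blast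
    moreover have "open ((+) p0 ` open_wedge)" using open_open_wedge by (rule open_translation)
    moreover have "p \<in> (+) p0 ` open_wedge"
    proof (rule image_eqI)
      show "p = p0 + (1 - 1 / t) *\<^sub>R p" by (simp add: p0_def algebra_simps)
      have c: "1 - 1 / t > 0" using t by simp
      have "0 < p $ 2" "p $ 2 < s * p $ 1" using p by (auto simp: open_wedge_def)
      then have "0 < (1 - 1 / t) * p $ 2" "(1 - 1 / t) * p $ 2 < (1 - 1 / t) * (s * p $ 1)"
        using c by (auto intro: mult_pos_pos mult_strict_left_mono)
      then show "(1 - 1 / t) *\<^sub>R p \<in> open_wedge" unfolding open_wedge_def by (simp add: mult.left_commute)
    qed
    ultimately have "p \<in> interior H" by (meson interior_maximal subsetD)
    then show False using p by (simp add: frontier_def)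
  qed
  then have "p \<in> closed_segment (V k) (V (Suc k))" using p0 by (simp add: p0_def)
  then show "p \<in> broken_line - {V 0}" using p V_0_notin_open_wedge by (auto simp: broken_line_def)
next
  fix p assume "p \<in> broken_line - {V 0}"
  then obtain k where k: "p \<in> closed_segment (V k) (V (Suc k))" "p \<noteq> V 0"
    by (auto simp: broken_line_def)
  have pc: "p \<in> open_wedge" using segment_in_open_wedge k by blast
  have "p \<in> closure H" using k segment_in_H closure_subset by blast
  moreover have "p \<notin> interior H"
  proof
    assume "p \<in> interior H"
    then obtain e where e: "e > 0" "cball p e \<subseteq> H" unfolding mem_interior_cball by blast
    have "p \<noteq> 0" using pc by (auto simp: open_wedge_def)
    then have np: "norm p > 0" by simp
    \<comment> \<open>The point at distance \<open>e\<close> from \<open>p\<close> in the direction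
      of the origin, where the functional of \<open>W k\<close> has dropped below 1.\<close>
    have "(1 - e / norm p) *\<^sub>R p \<in> cball p e"
      using e np by (simp add: dist_norm algebra_simps)
    then have "det2 ((1 - e / norm p) *\<^sub>R p) (W k) \<ge> 1" using e H_halfplane by blast
    then have "1 - e / norm p \<ge> 1" using det2_W_segment[OF k(1)] by simp
    moreover have "e / norm p > 0" using e np by simp
    ultimately show False by linarith
  qed
  ultimately show "p \<in> frontier H \<inter> open_wedge" using pc by (simp add: frontier_def)
qed

text \<open>Local finiteness: below height \<open>N\<close> only the first \<open>N\<close> edges
  occur, and their union is closed.\<close>

lemma closed_broken_line: "closed broken_line"
proof -
  have "closure broken_line \<subseteq> broken_line"
  proof
    fix p assume p: "p \<in> closure broken_line"
    obtain N :: nat where N: "real N > p $ 2" using reals_Archimedean2 by blast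
    let ?U = "{q :: real^2. q $ 2 < real N}" and ?F = "\<Union>k<N. closed_segment (V k) (V (Suc k))"
    have "?U \<inter> broken_line \<subseteq> ?F"
    proof
      fix q assume q: "q \<in> ?U \<inter> broken_line"
      then obtain k where k: "q \<in> closed_segment (V k) (V (Suc k))" by (auto simp: broken_line_def)
      then obtain u where u: "0 \<le> u" "u \<le> 1" "q = (1 - u) *\<^sub>R V k + u *\<^sub>R V (Suc k)"
        by (auto simp: in_segment)
      have "q $ 2 = V k $ 2 + u * (V (Suc k) $ 2 - V k $ 2)"
        unfolding u(3) by (simp add: algebra_simps)
      moreover have "u * (V (Suc k) $ 2 - V k $ 2) \<ge> 0" using u V_2_Suc[of k] by simp
      ultimately have "real k < real N" using q V_2_ge[of k] by simp
      then show "q \<in> ?F" using k by auto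
    qed
    moreover have "open ?U" by (intro open_Collect_less continuous_intros)
    then have "p \<in> closure (?U \<inter> broken_line)" using open_Int_closure_subset p N by blast
    moreover have "closed ?F" by (intro closed_UN) auto
    ultimately have "p \<in> ?F" by (meson closure_minimal subsetD)
    then show "p \<in> broken_line" by (auto simp: broken_line_def)
  qed
  then show ?thesis by (simp add: closure_subset_eq)
qed

lemma sail_larctan: "sail (larctan s) = broken_line"
proof -
  have "sail (larctan s) = closure (broken_line - {V 0})"
    using frontier_H_Int_open_wedge
    unfolding sail_def angle_cone_larctan interior_wedge H_def by (simp add: larctan_def angle_of_def)
  also have "\<dots> = broken_line"
  proof
    show "closure (broken_line - {V 0}) \<subseteq> broken_line"
      using closed_broken_line by (intro closure_minimal) auto
    \<comment> \<open>The starting point lies on the boundary ray; the closure restores it as a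
      limit of the first open edge.\<close>
    have "V 0 \<noteq> V (Suc 0)" using inj_V by (auto dest: injD)
    then have "V 0 \<in> closure (open_segment (V 0) (V (Suc 0)))" by simp
    also have "\<dots> \<subseteq> closure (broken_line - {V 0})"
      by (intro closure_mono) (auto simp: broken_line_def open_segment_def)
    finally show "broken_line \<subseteq> closure (broken_line - {V 0})"
      using closure_subset[of "broken_line - {V 0}"] by blast
  qed
  finally show ?thesis .
qed

section \<open>Vertices of the sail and their order\<close>

lemma broken_line_halfplane: "p \<in> broken_line \<Longrightarrow> det2 p (W k) \<ge> 1"
  unfolding broken_line_def using segment_in_H H_halfplane by blast

lemma broken_line_nonneg: "p \<in> broken_line \<Longrightarrow> p $ 2 \<ge> 0"
  using segment_in_open_wedge[of p] V_nonneg[of 0]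
  by (cases "p = V 0") (auto simp: broken_line_def open_wedge_def intro: less_imp_le)

lemma V_in_broken_line: "V k \<in> broken_line"
  by (auto simp: broken_line_def)

text \<open>Two independent supporting lines meet at \<open>V k\<close>. By the extremal principle
  both \<open>p\<close> and \<open>q\<close> would lie on each of them, so they would
  coincide.\<close>

lemma V_not_between:
  assumes "p \<in> broken_line" "q \<in> broken_line"
  shows "V k \<notin> open_segment p q"
proof
  assume "V k \<in> open_segment p q"
  then obtain u where u: "0 < u" "u < 1" "V k = (1 - u) *\<^sub>R p + u *\<^sub>R q" and "p \<noteq> q"
    by (auto simp: in_segment)
  have eq: "det2 p (W j) = 1 \<and> det2 q (W j) = 1" if "det2 (V k) (W j) = 1" for j
  proof -
    have "(1 - u) * det2 p (W j) + u * det2 q (W j) = 1" using that unfolding u(3) by simp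
    then show ?thesis
      using convex_combination_min[OF u(1,2)] broken_line_halfplane assms by blast
  qed
  have "p = q"
  proof (cases k)
    case 0
    \<comment> \<open>Only one edge ends at \<open>V 0\<close>; the second supporting line is the
      first coordinate axis, where the height is minimal.\<close>
    have "(1 - u) * p $ 2 + u * q $ 2 = 0"
      using arg_cong[OF u(3), of "\<lambda>v. v $ 2"] 0 by (simp add: V_0)
    then have "p $ 2 = 0" "q $ 2 = 0"
      using convex_combination_min[OF u(1,2)] broken_line_nonneg assms by blast+
    then show ?thesis
      using eq[of k] det2_V_W[of k] 0 by (intro vec2_eqI) (auto simp: det2_def W_def)
  next
    case (Suc j)
    have "det2 (W j) (W k) \<noteq> 0"
      using det2_V_W_after[where k = j and m = 0] det2_swap[of "W j" "W k"] Suc by simp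
    moreover have "det2 (W j) p = det2 (W j) q" "det2 (W k) p = det2 (W k) q"
      using eq[of k] eq[of j] det2_V_W[of k] det2_V_Suc_W[of j] Suc
        det2_swap[of "W j" p] det2_swap[of "W j" q] det2_swap[of "W k" p] det2_swap[of "W k" q]
      by simp_all
    ultimately show ?thesis by (rule det2_eqI)
  qed
  then show False using \<open>p \<noteq> q\<close> by simp
qed

lemma sail_vertices_larctan: "sail_vertices (larctan s) = range V"
proof (intro equalityI subsetI)
  fix v assume "v \<in> sail_vertices (larctan s)"
  then obtain k where k: "v \<in> closed_segment (V k) (V (Suc k))"
    and "\<not> (\<exists>p q. closed_segment p q \<subseteq> broken_line \<and> v \<in> open_segment p q)"
    unfolding sail_vertices_def sail_larctan by (auto simp: broken_line_def)
  then have "v \<notin> open_segment (V k) (V (Suc k))" by (auto simp: broken_line_def)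
  then show "v \<in> range V" using k by (auto simp: open_segment_def)
next
  fix v assume "v \<in> range V"
  then obtain k where k: "v = V k" by auto
  have "\<not> (\<exists>p q. closed_segment p q \<subseteq> broken_line \<and> v \<in> open_segment p q)"
    using V_not_between k by (meson ends_in_segment subsetD)
  then show "v \<in> sail_vertices (larctan s)"
    unfolding sail_vertices_def sail_larctan using k V_in_broken_line V_in_int_lattice by auto
qed

text \<open>The midpoint lies on some edge \<open>k\<close>, where the functional of
  \<open>W k\<close> takes its minimum 1. Both ends then have value 1, which only \<open>V k\<close>
  and \<open>V (Suc k)\<close> do.\<close>

lemma segment_in_broken_line_adjacent:
  assumes "closed_segment (V i) (V j) \<subseteq> broken_line" "i \<noteq> j"
  shows "j = Suc i \<or> i = Suc j"
proof -
  define m where "m = (1 - 1 / 2) *\<^sub>R V i + (1 / 2) *\<^sub>R V j"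
  have "m \<in> closed_segment (V i) (V j)"
    unfolding in_segment m_def by (intro exI[of _ "1 / 2"]) simp
  then obtain k where k: "m \<in> closed_segment (V k) (V (Suc k))"
    using assms(1) by (auto simp: broken_line_def)
  then have *: "(1 - 1 / 2) * det2 (V i) (W k) + 1 / 2 * det2 (V j) (W k) = 1"
    using det2_W_segment[OF k] by (simp add: m_def)
  have "det2 (V i) (W k) = 1" "det2 (V j) (W k) = 1"
    by (rule convex_combination_min[OF _ _ *];
        simp add: broken_line_halfplane[OF V_in_broken_line])+
  then show ?thesis using det2_V_W_eq_1 assms(2) by blast
qed

text \<open>Uniqueness: height 0 singles out the start, each later vertex is a neighbour of the one
  before it, and injectivity forbids stepping back.\<close>

lemma sail_vertex_seq_larctan: "sail_vertex_seq (larctan s) U \<longleftrightarrow> U = V"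
proof
  assume "U = V"
  moreover have "V 0 \<in> ray1 (larctan s)"
    by (auto simp: larctan_def angle_of_def ray_def V_0 intro: exI[of _ 1])
  ultimately show "sail_vertex_seq (larctan s) U"
    unfolding sail_vertex_seq_def sail_vertices_larctan sail_larctan
    using inj_V by (auto simp: broken_line_def)
next
  assume "sail_vertex_seq (larctan s) U"
  then have U: "inj U" "range U = range V" "U 0 \<in> ray 0 (vector [1, 0])"
    "closed_segment (U n) (U (Suc n)) \<subseteq> broken_line" for n
    unfolding sail_vertex_seq_def sail_vertices_larctan sail_larctan
    by (auto simp: larctan_def angle_of_def)
  have "U n = V n" for n
  proof (induction n rule: less_induct)
    case (less n)
    obtain j where j: "U n = V j" using U(2) by (metis rangeE rangeI)
    show ?case
    proof (cases n)
      case 0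
      then have "V j $ 2 = 0" using U(3) j by (auto simp: ray_def)
      then show ?thesis using j V_2_ge[of j] 0 by simp
    next
      case (Suc m)
      then have m: "U m = V m" using less by simp
      have "j \<noteq> m" using U(1) j m Suc by (metis injD n_not_Suc_n)
      then have "j = Suc m \<or> m = Suc j"
        using segment_in_broken_line_adjacent[of m j] U(4)[of m] j m Suc by simp
      moreover have "m \<noteq> Suc j"
      proof
        assume *: "m = Suc j"
        then have "U j = V j" using less Suc by simp
        then show False using U(1) j * Suc by (metis injD n_not_Suc_n less_SucI less_irrefl lessI)
      qed
      ultimately show ?thesis using j Suc by simp
    qed
  qed
  then show "U = V" by blast
qed

end

section \<open>Transport along lattice frames\<close>

lemma ray_scaleR: "c > 0 \<Longrightarrow> ray Y (Y + c *\<^sub>R p) = ray Y (Y + p)"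
proof (intro equalityI subsetI)
  assume c: "c > 0"
  fix z assume "z \<in> ray Y (Y + c *\<^sub>R p)"
  then obtain t where "t \<ge> 0" "z = Y + (t * c) *\<^sub>R (Y + p - Y)" by (auto simp: ray_def)
  moreover from this c have "t * c \<ge> 0" by simp
  ultimately show "z \<in> ray Y (Y + p)" unfolding ray_def by blast
next
  assume c: "c > 0"
  fix z assume "z \<in> ray Y (Y + p)"
  then obtain t where "t \<ge> 0" "z = Y + (t / c) *\<^sub>R (Y + c *\<^sub>R p - Y)" using c by (auto simp: ray_def)
  moreover from this c have "t / c \<ge> 0" by simp
  ultimately show "z \<in> ray Y (Y + c *\<^sub>R p)" unfolding ray_def by blast
qed

text \<open>The absolute value admits orientation-reversing frames, which serve angles whose second
  ray lies clockwise from the first.\<close>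

locale lattice_frame =
  fixes Y u v :: "real^2"
  assumes Y_lattice: "Y \<in> int_lattice" and u_lattice: "u \<in> int_lattice"
    and v_lattice: "v \<in> int_lattice" and unimodular: "\<bar>det2 u v\<bar> = 1"
begin

definition L :: "real^2 \<Rightarrow> real^2" where "L p = p $ 1 *\<^sub>R u + p $ 2 *\<^sub>R v"
definition T :: "real^2 \<Rightarrow> real^2" where "T p = Y + L p"

lemma linear_L: "linear L"
  by (rule linearI) (simp_all add: L_def algebra_simps)

lemma det2_u_L: "det2 u (L p) = p $ 2 * det2 u v" and det2_L_v: "det2 (L p) v = p $ 1 * det2 u v"
  by (simp_all add: L_def)

lemma det2_L: "det2 (L p) (L q) = det2 u v * det2 p q"
  using det2_swap[of v u] by (simp add: L_def det2_def[of p q] algebra_simps)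

lemma inj_L: "inj L"
proof (rule injI)
  fix p q assume "L p = L q"
  then have "p $ 2 * det2 u v = q $ 2 * det2 u v" "p $ 1 * det2 u v = q $ 1 * det2 u v"
    by (simp_all flip: det2_u_L det2_L_v)
  then show "p = q" using unimodular by (intro vec2_eqI) auto
qed

lemma inj_T: "inj T"
  using inj_L by (simp add: T_def inj_def)

lemma L_in_int_lattice_iff: "L p \<in> int_lattice \<longleftrightarrow> p \<in> int_lattice"
proof
  assume "p \<in> int_lattice"
  then show "L p \<in> int_lattice" using u_lattice v_lattice by (simp add: L_def int_lattice_def)
next
  assume Lp: "L p \<in> int_lattice"
  have sq: "det2 u v = 1 \<or> det2 u v = -1" using unimodular by linarith
  have "p $ 1 * det2 u v \<in> \<int>" "p $ 2 * det2 u v \<in> \<int>"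
    using det2_in_Ints[OF u_lattice Lp] det2_in_Ints[OF Lp v_lattice]
    by (simp_all add: det2_u_L det2_L_v)
  then show "p \<in> int_lattice" using sq by (auto simp: int_lattice_def forall_2)
qed

lemma T_in_int_lattice_iff: "T p \<in> int_lattice \<longleftrightarrow> p \<in> int_lattice"
proof -
  have "L p = T p - Y" by (simp add: T_def)
  then have "T p \<in> int_lattice \<longleftrightarrow> L p \<in> int_lattice"
    using Y_lattice int_lattice_intros(2,3) T_def by metis
  then show ?thesis by (simp only: L_in_int_lattice_iff)
qed

text \<open>Factoring \<open>T\<close> into a linear map and a translation lets hulls, closures,
  interiors and segments be transported in two known steps.\<close>

lemma T_image: "T ` S = (+) Y ` L ` S"
  by (auto simp: T_def)

lemma surj_T: "surj T"
proof -
  have "surj L" using linear_L inj_L by (simp add: linear_injective_imp_surjective)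
  then show ?thesis unfolding T_image by (simp add: surj_plus)
qed

lemma int_lattice_T: "int_lattice = T ` int_lattice"
proof (intro equalityI subsetI)
  fix p assume p: "p \<in> int_lattice"
  obtain q where q: "p = T q" using surj_T by blast
  then show "p \<in> T ` int_lattice" using p T_in_int_lattice_iff by blast
qed (use T_in_int_lattice_iff in blast)

lemma convex_hull_T: "convex hull (T ` S) = T ` (convex hull S)"
  unfolding T_image by (simp add: convex_hull_translation convex_hull_linear_image[OF linear_L])

lemma closure_T: "closure (T ` S) = T ` closure S"
  unfolding T_image by (simp add: closure_translation closure_injective_linear_image[OF linear_L inj_L])

lemma interior_T: "interior (T ` S) = T ` interior S"
  unfolding T_image by (simp add: interior_translation interior_injective_linear_image[OF linear_L inj_L])

lemma frontier_T: "frontier (T ` S) = T ` frontier S"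
  unfolding frontier_def closure_T interior_T by (rule image_set_diff[OF inj_T, symmetric])

lemma closed_segment_T: "closed_segment (T p) (T q) = T ` closed_segment p q"
  unfolding T_image by (simp add: T_def closed_segment_translation closed_segment_linear_image[OF linear_L])

lemma open_segment_T: "open_segment (T p) (T q) = T ` open_segment p q"
  unfolding T_image
  by (simp add: T_def open_segment_translation open_segment_linear_image[OF linear_L inj_L])

lemma ray_T: "T ` ray 0 p = ray Y (T p)"
proof -
  have "T (t *\<^sub>R p) = Y + t *\<^sub>R (T p - Y)" for t by (simp add: T_def L_def algebra_simps)
  moreover have "ray 0 p = (\<lambda>t. t *\<^sub>R p) ` {0..}" "ray Y (T p) = (\<lambda>t. Y + t *\<^sub>R (T p - Y)) ` {0..}"
    by (auto simp: ray_def)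
  ultimately show ?thesis by (simp add: image_image)
qed

definition angle_image :: "angle \<Rightarrow> angle" where
  "angle_image \<alpha> = Angle (T (vertex \<alpha>)) (T ` ray1 \<alpha>) (T ` ray2 \<alpha>)"

lemma angle_image_simps [simp]: "vertex (angle_image \<alpha>) = T (vertex \<alpha>)"
  "ray1 (angle_image \<alpha>) = T ` ray1 \<alpha>" "ray2 (angle_image \<alpha>) = T ` ray2 \<alpha>"
  by (simp_all add: angle_image_def)

lemma angle_cone_T: "angle_cone (angle_image \<alpha>) = T ` angle_cone \<alpha>"
  by (simp add: angle_cone_def convex_hull_T flip: image_Un)

lemma sail_T: "sail (angle_image \<alpha>) = T ` sail \<alpha>"
proof -
  have "angle_cone (angle_image \<alpha>) \<inter> int_lattice - {vertex (angle_image \<alpha>)} =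
      T ` angle_cone \<alpha> \<inter> T ` int_lattice - T ` {vertex \<alpha>}"
    by (simp add: angle_cone_T flip: int_lattice_T)
  also have "\<dots> = T ` (angle_cone \<alpha> \<inter> int_lattice - {vertex \<alpha>})"
    by (simp only: image_Int[OF inj_T] image_set_diff[OF inj_T])
  finally have *: "angle_cone (angle_image \<alpha>) \<inter> int_lattice - {vertex (angle_image \<alpha>)} =
      T ` (angle_cone \<alpha> \<inter> int_lattice - {vertex \<alpha>})" .
  show ?thesis
    unfolding sail_def * unfolding angle_cone_T convex_hull_T frontier_T interior_T
      image_Int[OF inj_T, symmetric] closure_T ..
qed

lemma between_T:
  "(\<exists>p q. closed_segment p q \<subseteq> T ` S \<and> T z \<in> open_segment p q) \<longleftrightarrow>
   (\<exists>p q. closed_segment p q \<subseteq> S \<and> z \<in> open_segment p q)"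
proof (intro iffI; elim exE conjE)
  fix p q assume pq: "closed_segment p q \<subseteq> T ` S" "T z \<in> open_segment p q"
  obtain p' q' where "p = T p'" "q = T q'" using surj_T by blast
  then have "closed_segment p' q' \<subseteq> S" "z \<in> open_segment p' q'"
    using pq by (simp_all add: closed_segment_T open_segment_T inj_image_subset_iff[OF inj_T]
        inj_image_mem_iff[OF inj_T])
  then show "\<exists>p q. closed_segment p q \<subseteq> S \<and> z \<in> open_segment p q" by blast
next
  fix p q assume "closed_segment p q \<subseteq> S" "z \<in> open_segment p q"
  then have "closed_segment (T p) (T q) \<subseteq> T ` S" "T z \<in> open_segment (T p) (T q)"
    by (auto simp: closed_segment_T open_segment_T)
  then show "\<exists>p q. closed_segment p q \<subseteq> T ` S \<and> T z \<in> open_segment p q" by blast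
qed

lemma sail_vertices_T: "sail_vertices (angle_image \<alpha>) = T ` sail_vertices \<alpha>"
proof (rule set_eqI)
  fix p
  obtain z where z: "p = T z" using surj_T by blast
  show "p \<in> sail_vertices (angle_image \<alpha>) \<longleftrightarrow> p \<in> T ` sail_vertices \<alpha>"
    by (simp only: z sail_vertices_def sail_T mem_Collect_eq Int_iff T_in_int_lattice_iff
        inj_image_mem_iff[OF inj_T] between_T)
qed

lemma sail_vertex_seq_T: "sail_vertex_seq (angle_image \<alpha>) (T \<circ> U) \<longleftrightarrow> sail_vertex_seq \<alpha> U"
proof -
  have "inj (T \<circ> U) \<longleftrightarrow> inj U" using inj_T by (metis inj_compose inj_on_imageI2)
  moreover have "range (T \<circ> U) = T ` sail_vertices \<alpha> \<longleftrightarrow> range U = sail_vertices \<alpha>"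
    unfolding image_comp[symmetric] by (rule inj_image_eq_iff[OF inj_T])
  ultimately show ?thesis
    by (simp add: sail_vertex_seq_def sail_vertices_T sail_T closed_segment_T
        inj_image_subset_iff[OF inj_T] inj_image_mem_iff[OF inj_T])
qed

lemma lattice_affine_T: "lattice_affine T"
proof -
  obtain a b c d :: int where ab: "u $ 1 = a" "u $ 2 = b" "v $ 1 = c" "v $ 2 = d"
    using u_lattice v_lattice by (auto simp: int_lattice_def forall_2 elim!: Ints_cases)
  obtain y1 y2 :: int where y: "Y $ 1 = y1" "Y $ 2 = y2"
    using Y_lattice by (auto simp: int_lattice_def forall_2 elim!: Ints_cases)
  define \<delta> where "\<delta> = a * d - b * c"
  have "det2 u v = of_int \<delta>" by (simp add: det2_def ab \<delta>_def)
  then have "\<delta> * \<delta> = 1" using unimodular by (metis abs_mult_self_eq mult_1 of_int_abs of_int_eq_1_iff)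
  then have inverse: "a * (\<delta> * d) + c * (- \<delta> * b) = 1" "b * (- \<delta> * c) + d * (\<delta> * a) = 1"
    by (simp_all add: \<delta>_def algebra_simps)
  define M :: "int^2^2" where "M = vector [vector [a, c], vector [b, d]]"
  \<comment> \<open>The adjugate of \<open>M\<close> times \<open>\<delta>\<close>, which is its own
    inverse; so \<open>N\<close> is the integral inverse of \<open>M\<close>.\<close>
  define N :: "int^2^2" where "N = vector [vector [\<delta> * d, - \<delta> * c], vector [- \<delta> * b, \<delta> * a]]"
  have "M ** N = mat 1" "N ** M = mat 1"
    using inverse unfolding M_def N_def
    by (simp_all add: vec_eq_iff forall_2 matrix_matrix_mult_def sum_2 mat_def algebra_simps)
  then have "invertible M" unfolding invertible_def by blast
  moreover have "T = (\<lambda>x. (\<chi> i j. real_of_int (M $ i $ j)) *v x + (\<chi> i. real_of_int (vector [y1, y2] $ i)))"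
    by (rule ext, rule vec2_eqI)
      (simp_all add: T_def L_def ab y M_def matrix_vector_mult_def sum_2 algebra_simps)
  ultimately show ?thesis unfolding lattice_affine_def by blast
qed

end

locale framed_slope = lattice_frame Y u v + irrational_slope s for Y u v s
begin

lemma sail_vertex_image: "sail_vertex (angle_image (larctan s)) = T \<circ> V"
  unfolding sail_vertex_def
proof (rule the_equality)
  show "sail_vertex_seq (angle_image (larctan s)) (T \<circ> V)"
    by (simp add: sail_vertex_seq_T sail_vertex_seq_larctan)
  fix U assume U: "sail_vertex_seq (angle_image (larctan s)) U"
  \<comment> \<open>Pulling \<open>U\<close> back along \<open>T\<close> reduces uniqueness to the
    standard angle.\<close>
  have "T \<circ> (inv T \<circ> U) = U" using surj_T by (simp add: fun_eq_iff surj_f_inv_f)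
  then show "U = T \<circ> V" using U sail_vertex_seq_T sail_vertex_seq_larctan by metis
qed

lemma primitive_L_W: "primitive_vector (L (W k))"
proof (rule primitive_vectorI)
  show "\<bar>det2 (L (W k)) (L (V k))\<bar> = 1"
    using unimodular det2_V_W[of k] det2_swap[of "W k" "V k"] by (simp add: det2_L abs_mult)
qed (simp_all add: L_in_int_lattice_iff V_in_int_lattice W_in_int_lattice)

lemma T_V_Suc: "T (V (Suc k)) = T (V k) + of_int (a (2 * k)) *\<^sub>R L (W k)"
  by (simp add: T_def V_Suc linear_add[OF linear_L] linear_scale[OF linear_L])

lemma ltan_coeff_image: "ltan_coeff (angle_image (larctan s)) n = of_int (a n)"
proof (cases "even n")
  case True
  then obtain k where k: "n = 2 * k" by blast
  have "real_of_int (a (2 * k)) = real (nat (a (2 * k)))"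
    using partial_quotient_ge_1[of "2 * k"] by simp
  then have "T (V (Suc k)) = T (V k) + real (nat (a (2 * k))) *\<^sub>R L (W k)"
    unfolding T_V_Suc by (rule arg_cong)
  then have "lattice_length (T (V k)) (T (V (Suc k))) = nat (a (2 * k))"
    using lattice_length_primitive[OF _ primitive_L_W] T_in_int_lattice_iff V_in_int_lattice by metis
  then show ?thesis using k partial_quotient_ge_1[of "2 * k"]
    by (simp add: ltan_coeff_def sail_vertex_image)
next
  case False
  then obtain k where k: "n = 2 * k + 1" by (rule oddE)
  let ?Q = "T (V (Suc k))"
  \<comment> \<open>At the vertex \<open>?Q\<close> the edge back runs along
    \<open>- L (W k)\<close> and the edge forward along \<open>L (W (Suc k))\<close>. Since
    \<open>W (Suc k) - W k\<close> is \<open>a (2 * k + 1)\<close> times \<open>V (Suc k)\<close>,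
    the determinant of the two directions is that quotient up to sign.\<close>
  have "det2 (W k) (W (Suc k)) = - of_int (a (2 * k + 1))"
    using det2_V_Suc_W[of k] det2_swap[of "W k" "V (Suc k)"] by (simp add: W_Suc)
  then have det: "\<bar>det2 (- L (W k)) (L (W (Suc k)))\<bar> = of_int (a (2 * k + 1))"
    using unimodular real_partial_quotient_ge_1[of "2 * k + 1"] by (simp add: det2_L abs_mult)
  have "primitive_vector (- L (W k))"
    using primitive_L_W[of k] unfolding primitive_vector_def
    by (force simp: vec_eq_iff forall_2 intro: exI[of _ "- _"])
  then have "lsin (?Q + of_int (a (2 * k)) *\<^sub>R (- L (W k))) ?Q
      (?Q + of_int (a (2 * Suc k)) *\<^sub>R L (W (Suc k))) = \<bar>det2 (- L (W k)) (L (W (Suc k)))\<bar>"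
    using real_partial_quotient_ge_1[of "2 * k"] real_partial_quotient_ge_1[of "2 * Suc k"]
      real_partial_quotient_ge_1[of "2 * k + 1"] det
    by (intro lsin_primitive primitive_L_W) (auto simp: T_in_int_lattice_iff V_in_int_lattice)
  moreover have "?Q + of_int (a (2 * k)) *\<^sub>R (- L (W k)) = T (V k)" by (simp add: T_V_Suc)
  ultimately have "lsin (T (V k)) ?Q (T (V (Suc (Suc k)))) = of_int (a (2 * k + 1))"
    unfolding det T_V_Suc[of "Suc k"] by simp
  then show ?thesis using k by (simp add: ltan_coeff_def sail_vertex_image)
qed

lemma ltan_image: "ltan (angle_image (larctan s)) = s"
  using infinite_cfrac_partial_quotient by (simp add: ltan_def ltan_coeff_image[abs_def])

end

lemma ltan_larctan:
  assumes "s \<notin> \<rat>" "s > 1"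
  shows "ltan (larctan s) = s"
proof -
  interpret framed_slope 0 "vector [1, 0]" "vector [0, 1]" s
    using assms by unfold_locales (auto simp: det2_def)
  have "T p = p" for p by (rule vec2_eqI) (simp_all add: T_def L_def)
  then have "angle_image (larctan s) = larctan s" by (cases "larctan s") (simp add: angle_image_def)
  then show ?thesis using ltan_image by simp
qed

text \<open>The frame starts from the primitive vector on the first ray. Its second vector is
  determined up to sign and a shear; the sign puts it on the side of the second ray, and the shear
  makes the slope of that ray exceed 1.\<close>

lemma R_irrational_angle_framed:
  assumes "R_irrational_angle \<alpha>"
  obtains Y u v s where "framed_slope Y u v s" "\<alpha> = lattice_frame.angle_image Y u v (larctan s)"
proof -
  obtain A Y B where \<alpha>: "\<alpha> = angle_of A Y B" and Y: "Y \<in> int_lattice"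
    and ncol: "\<not> collinear {Y, A, B}" and "(ray Y A - {Y}) \<inter> int_lattice \<noteq> {}"
    and irr: "(ray Y B - {Y}) \<inter> int_lattice = {}"
    using assms unfolding R_irrational_angle_def by blast
  then obtain X where X: "X \<in> ray Y A" "X \<noteq> Y" "X \<in> int_lattice" by blast
  then obtain t where t: "t \<ge> 0" "X - Y = t *\<^sub>R (A - Y)" by (auto simp: ray_def)
  then have t0: "t > 0" using X(2) by (cases "t = 0") auto
  obtain u r where u: "primitive_vector u" "r > 0" "X - Y = r *\<^sub>R u"
    using primitive_vector_along[of "X - Y"] X Y by auto
  define c where "c = r / t"
  have c: "c > 0" using u(2) t0 by (simp add: c_def)
  have "A - Y = (1 / t) *\<^sub>R (X - Y)" using t(2) t0 by simp
  then have "A - Y = c *\<^sub>R u" using u(3) by (simp add: c_def)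
  then have A: "A = Y + c *\<^sub>R u" by (simp add: algebra_simps)
  have ul: "u \<in> int_lattice" using u(1) by (rule primitive_vector_in_int_lattice)
  obtain w where w: "w \<in> int_lattice" "det2 u w = 1"
    using primitive_vector_complement[OF u(1), of 1] by auto
  \<comment> \<open>The sign turns \<open>w\<close> to the side of \<open>B\<close>, so that the
    coordinate \<open>y\<close> is positive; \<open>\<sigma> = -1\<close> leads to an
    orientation-reversing frame.\<close>
  define \<sigma> where "\<sigma> = sgn (det2 u (B - Y))"
  define y where "y = \<bar>det2 u (B - Y)\<bar>"
  have "det2 u (B - Y) \<noteq> 0"
  proof
    assume 0: "det2 u (B - Y) = 0"
    define b where "b = det2 (B - Y) w"
    have "B - Y = b *\<^sub>R u" using det2_cramer[of u w "B - Y"] w 0 by (simp add: b_def)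
    then have B: "B = Y + b *\<^sub>R u" by (simp add: algebra_simps)
    have "Y = Y + 0 *\<^sub>R u" by simp
    then have "\<forall>p\<in>{Y, A, B}. \<exists>k. p = Y + k *\<^sub>R u" using A B by blast
    then have "\<forall>p\<in>{Y, A, B}. \<forall>q\<in>{Y, A, B}. \<exists>k. p - q = k *\<^sub>R u"
      by (metis add_diff_cancel_left scaleR_diff_left)
    then show False using ncol unfolding collinear_def by blast
  qed
  then have y: "y > 0" "\<sigma> = 1 \<or> \<sigma> = -1" "\<sigma> * y = det2 u (B - Y)"
    by (auto simp: y_def \<sigma>_def sgn_if)
  define x where "x = det2 (B - Y) w"
  have "B - Y = x *\<^sub>R u + (\<sigma> * y) *\<^sub>R w"
    using det2_cramer[of u w "B - Y"] w y(3) by (simp add: x_def)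
  then have BY: "B - Y = x *\<^sub>R u + y *\<^sub>R (\<sigma> *\<^sub>R w)" by (simp add: mult.commute)
  have \<sigma>w: "\<sigma> *\<^sub>R w \<in> int_lattice" using w y(2) by auto
  have xy: "x / y \<notin> \<rat>"
  proof
    assume "x / y \<in> \<rat>"
    then obtain m n where mn: "n \<noteq> 0" "\<bar>x / y\<bar> = real m / real n" by (rule Rats_abs_nat_div_natE)
    have "\<bar>x / y * real n\<bar> = \<bar>x / y\<bar> * real n" by (simp add: abs_mult)
    also have "\<dots> = real m" unfolding mn(2) using mn(1) by simp
    finally have "x / y * real n = real m \<or> x / y * real n = - real m" by linarith
    then have int: "x / y * real n \<in> \<int>" by (metis Ints_minus Ints_of_nat)
    \<comment> \<open>Scaled so that the coordinate along \<open>\<sigma> *\<^sub>R w\<close> is the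
      integer \<open>n\<close>; the one along \<open>u\<close> is then \<open>m\<close> or
      \<open>-m\<close>, and the second ray would carry a lattice point.\<close>
    define Z where "Z = Y + (real n / y) *\<^sub>R (B - Y)"
    have "Z = Y + (x / y * real n) *\<^sub>R u + real n *\<^sub>R (\<sigma> *\<^sub>R w)"
      unfolding Z_def BY using y(1) by (simp add: scaleR_add_right)
    also have "\<dots> \<in> int_lattice"
      by (intro int_lattice_intros Y ul \<sigma>w int) simp
    finally have "Z \<in> int_lattice" .
    moreover have "Z \<in> ray Y B" using y(1) unfolding ray_def Z_def
      by (intro CollectI exI[of _ "real n / y"]) simp
    moreover have "Z \<noteq> Y"
    proof -
      have "B - Y \<noteq> 0" using \<open>det2 u (B - Y) \<noteq> 0\<close> by auto
      then show ?thesis using mn(1) y(1) by (simp add: Z_def)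
    qed
    ultimately show False using irr by blast
  qed
  \<comment> \<open>Shearing by the integer part gives \<open>B - Y = y (f u + v)\<close> with
    \<open>f\<close> strictly between 0 and 1, hence slope \<open>s = 1 / f\<close> above 1 in the
    frame.\<close>
  define k where "k = \<lfloor>x / y\<rfloor>"
  define f where "f = x / y - of_int k"
  have fi: "f \<notin> \<rat>" using xy unfolding f_def by (metis Rats_add Rats_of_int diff_add_cancel)
  then have "f \<noteq> 0" by (metis Rats_0)
  then have f: "0 < f" "f < 1" unfolding f_def k_def by linarith+
  define s where "s = 1 / f"
  define v where "v = \<sigma> *\<^sub>R w + of_int k *\<^sub>R u"
  have "framed_slope Y u v s"
  proof
    show "s \<notin> \<rat>" using fi unfolding s_def by (metis Rats_1 Rats_divide div_by_1 divide_divide_eq_right mult_1)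
    show "v \<in> int_lattice" using \<sigma>w ul by (auto simp: v_def)
    show "\<bar>det2 u v\<bar> = 1" using w(2) y(2) by (auto simp: v_def)
    show "s > 1" using f by (simp add: s_def)
  qed (fact Y ul)+
  then interpret framed_slope Y u v s .
  have "B - Y = (y * f) *\<^sub>R (u + s *\<^sub>R v)"
  proof -
    have "x = y * f + y * of_int k" using y(1) by (simp add: f_def algebra_simps)
    then have "B - Y = (y * f) *\<^sub>R u + y *\<^sub>R v" unfolding BY v_def by (simp add: algebra_simps)
    then show ?thesis using f(1) by (simp add: s_def scaleR_add_right)
  qed
  then have B: "B = Y + (y * f) *\<^sub>R (u + s *\<^sub>R v)" by (simp add: algebra_simps)
  have "ray Y B = ray Y (T (vector [1, s]))"
    unfolding B using ray_scaleR[of "y * f"] y(1) f(1) by (simp add: T_def L_def)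
  moreover have "ray Y A = ray Y (T (vector [1, 0]))"
    unfolding A using ray_scaleR[OF c] by (simp add: T_def L_def)
  moreover have "T 0 = Y" by (simp add: T_def L_def)
  ultimately have "\<alpha> = angle_image (larctan s)"
    by (simp add: \<alpha> angle_image_def larctan_def angle_of_def ray_T)
  then show thesis using that framed_slope_axioms by blast
qed

theorem theorem5p9:
  "(\<forall>s::real. s \<notin> \<rat> \<and> s > 1 \<longrightarrow> ltan (larctan s) = s) \<and>
   (\<forall>\<alpha>. R_irrational_angle \<alpha> \<longrightarrow>
      ltan \<alpha> \<notin> \<rat> \<and> ltan \<alpha> > 1 \<and> lattice_congruent (larctan (ltan \<alpha>)) \<alpha>)"
proof (intro conjI[OF _ allI] allI impI)
  fix s :: real assume "s \<notin> \<rat> \<and> s > 1"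
  then show "ltan (larctan s) = s" using ltan_larctan by blast
next
  fix \<alpha> assume "R_irrational_angle \<alpha>"
  then obtain Y u v s where "framed_slope Y u v s"
    and \<alpha>: "\<alpha> = lattice_frame.angle_image Y u v (larctan s)"
    by (rule R_irrational_angle_framed)
  then interpret framed_slope Y u v s by blast
  \<comment> \<open>The tangent recovers the slope chosen with the frame, so the frame map
    \<open>T\<close> itself is the required congruence.\<close>
  have "ltan \<alpha> = s" using ltan_image \<alpha> by simp
  moreover have "lattice_congruent (larctan s) \<alpha>"
    unfolding lattice_congruent_def \<alpha> using lattice_affine_T by (intro exI[of _ T]) simp
  ultimately show "ltan \<alpha> \<notin> \<rat> \<and> ltan \<alpha> > 1 \<and> lattice_congruent (larctan (ltan \<alpha>)) \<alpha>"
    using irrational gt_1 by simp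
qed

end
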